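(* Let $m\in\mathbb Z_{\ge0}$. For every $(\lambda,\alpha)\in\mathcal C(m)$, $\mathbf B(\lambda,\alpha)=\mathbf B_{\mathcal N(m)}(\lambda,\alpha)$ is a $\mathfrak{gl}_{\mathcal N(m)}$-crystal, and $$\mathbf B(\lambda,\alpha)=\{\,f_{i_1}\cdots f_{i_r}H_{(\lambda,\alpha)}\mid r\ge0,\ i_1,\dots,i_r\in I(m)\,\}\setminus\{\mathbf 0\}.$$ In particular, $\mathbf B(\lambda,\alpha)$ is connected with a unique highest weight element $H_{(\lambda,\alpha)}$.
   Context: $\mathcal N(m)=\{-m<\cdots<-1<\frac12<1<\frac32<2<\cdots\}$; integers are even, elements of $\frac12+\mathbb Z_{\ge0}$ are odd. $P=\bigoplus_{b\in\mathcal N(m)}\mathbb Z\epsilon_b$ with $(\epsilon_a,\epsilon_b)=(-1)^{|a|}\delta_{ab}$. Simple roots: $\alpha_i=\epsilon_{i-1}-\epsilon_i$ for $-m+1\le i\le-1$ (non-isotropic), and, isotropic, $\alpha_0=\epsilon_{-1}-\epsilon_{1/2}$ (if $m\ge1$) and $\alpha_r=\epsilon_r-\epsilon_{r+\frac12}$ for $r\in\frac12\mathbb Z_{>0}$; $I(m)$ is the index set. $\lambda\ge\mu$ in $P$ means $\lambda-\mu$ is a nonnegative integral combination of simple roots. A $\mathfrak{gl}_{\mathcal N(m)}$-crystal is a set $B$ with maps $\mathrm{wt}:B\to P$, $\varepsilon_i,\varphi_i:B\to\mathbb Z_{\ge0}$, $e_i,f_i:B\to B\cup\{\mathbf 0\}$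 ($i\in I(m)$, $\mathbf 0$ a formal symbol, $e_i\mathbf 0=f_i\mathbf 0=\mathbf 0$) such that: (1) for $\alpha_i$ isotropic, $\varphi_i(b)+\varepsilon_i(b)$ is $1$ if $(\mathrm{wt}(b),\alpha_i)\ne0$ and $0$ otherwise; (2) for $\alpha_i$ non-isotropic, $\varphi_i(b)-\varepsilon_i(b)=(\mathrm{wt}(b),\alpha_i)$; (3) if $e_ib\in B$ then $\varepsilon_i,\varphi_i,\mathrm{wt}$ change by $-1,+1,+\alpha_i$; (4) if $f_ib\in B$ then they change by $+1,-1,-\alpha_i$; (5) $f_ib=b'$ iff $b=e_ib'$. It is viewed as a colored oriented graph ($b\xrightarrow{i}b'$ iff $b'=f_ib$). $\mathcal N(m)$ is a crystal: $\mathrm{wt}(b)=\epsilon_b$, and $f_i b=b'$ iff $\alpha_i=\epsilon_b-\epsilon_{b'}$; $\varepsilon_i(b)$ (resp. $\varphi_i(b)$) is $1$ if $e_ib\ne\mathbf 0$ (resp. $f_ib\neq\mathbf 0$), else $0$. Tensor product $B_1\otimes B_2$: $\mathrm{wt}$ is additive. For $i\in\mathbb Z_{\ge0}$: $e_i,f_i$ act on $b_1$ if $(\alpha_i,\mathrm{wt}(b_1))\ne0$, otherwise on $b_2$. For $i\in\frac12+\mathbb Z_{\ge0}$: they act on $b_2$ if $(\alpha_i,\mathrm{wt}(b_2))\neq0$, otherwise on $b_1$. In both cases $\varepsilon_i,\varphi_i$ are those of the factor acted on. For $i\le-1$: $e_i(b_1\otimes b_2)=e_ib_1\otimes b_2$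 if $\varphi_i(b_1)\ge\varepsilon_i(b_2)$, else $b_1\otimes e_ib_2$; $f_i(b_1\otimes b_2)=f_ib_1\otimes b_2$ if $\varphi_i(b_1)>\varepsilon_i(b_2)$, else $b_1\otimes f_ib_2$; $\varepsilon_i(b_1\otimes b_2)=\max\{\varepsilon_i(b_1),\varepsilon_i(b_2)-(\alpha_i,\mathrm{wt}(b_1))\}$, $\varphi_i(b_1\otimes b_2)=\max\{\varphi_i(b_1)+(\alpha_i,\mathrm{wt}(b_2)),\varphi_i(b_2)\}$. The set $\mathbf W$ of finite words in $\mathcal N(m)$ is a crystal via $w_1\cdots w_r=w_1\otimes\cdots\otimes w_r$ (the empty word being a trivial crystal). $\mathcal C(m)$ is the set of pairs $(\lambda,\alpha)$ with $\lambda=(\lambda_1,\dots,\lambda_m)$ a partition of length at most $m$ and $\alpha$ a (possibly empty) composition that is non-empty only if $\lambda_m\neq0$; $\mathcal C(0)$ is the set of compositions. A composition is identified with its ribbon diagram (rows of lengths $\alpha_1,\alpha_2,\dots$ from top to bottom, the leftmost node of row $i+1$ directly below the rightmost node of row $i$). $(\lambda,\alpha)$ is identified with the diagram obtained by placing the first (northwest) node of $\alpha$ directly below the leftmost node in the $m$-th row of the Young diagram $\lambda$; $\lambda$ is the body, $\alpha$ the tail, and the first node of the tail is the joint. $\mathbf B(\lambda,\alpha)$ is the set of fillings $T$ of this diagram with entries in $\mathcal N(m)$ such that (1) $T$ is semistandard: entries weakly increase along rows (left to right) and columns (top to bottom), even entries strictly increase in columns, odd entries strictly increase in rows; (2) if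 the joint entry $b$ is in $\mathbb Z_{>0}$, all entries in the body are $<b$; (3) if the joint entry $b$ is in $\frac12+\mathbb Z_{\ge0}$, all entries in the body are $\le b$. $w(T)\in\mathbf W$ is obtained by reading rows top to bottom, each row right to left; the crystal structure on $\mathbf B(\lambda,\alpha)$ is the one given by identifying $T$ with $w(T)$ ($x_iT$ is the tableau of shape $(\lambda,\alpha)$ corresponding to $x_iw(T)$). $H_{(\lambda,\alpha)}$ is the tableau whose body has every entry of its $i$-th row equal to $-m+i-1$ and whose tail is $H_\alpha$: with tail nodes $x_1,x_2,\dots$ from northwest to southeast, $H_\alpha(x_1)=\frac12$; if $x_{k+1}$ is right of $x_k$, $H_\alpha(x_{k+1})=H_\alpha(x_k)$ if this is an integer and $H_\alpha(x_k)+\frac12$ otherwise; if $x_{k+1}$ is below $x_k$, $H_\alpha(x_{k+1})=H_\alpha(x_k)$ if this is in $\frac12+\mathbb Z_{\ge0}$ and $H_\alpha(x_k)+\frac12$ otherwise. A highest weight element of $B$ is an element $H$ with $\mathrm{wt}(H)\ge\mathrm{wt}(T)$ for all $T\in B$. *)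

theory Defs
  imports Complex_Main "HOL-Library.Poly_Mapping" "HOL-Library.FuncSet"
begin

section \<open>The ordered alphabet, the weight lattice and the simple roots\<close>

text \<open>
  Letters and indices are rationals with the usual order. Within the alphabet, a letter is even if
  it is an integer, and odd if it is a (positive) half-integer, so oddness is \<open>b \<notin> \<int>\<close>. The letter 0
  does not occur.
\<close>

definition letters :: "nat \<Rightarrow> rat set" where
  "letters m = {b. b \<in> \<int> \<and> - of_nat m \<le> b \<and> b \<le> -1} \<union> {b. 2 * b \<in> \<int> \<and> 0 < b}"

definition indices :: "nat \<Rightarrow> rat set" where
  "indices m =
     {i. i \<in> \<int> \<and> - of_nat m + 1 \<le> i \<and> i \<le> -1} \<union> {i. i = 0 \<and> m \<ge> 1} \<union> {i. 2 * i \<in> \<int> \<and> 0 < i}"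

type_synonym weight = "rat \<Rightarrow>\<^sub>0 int"

text \<open>The basis vector \<open>\<epsilon>\<^sub>b\<close> is \<open>frag_of b\<close>.\<close>

definition weights :: "nat \<Rightarrow> weight set" where
  "weights m = {p. Poly_Mapping.keys p \<subseteq> letters m}"

definition pairing :: "weight \<Rightarrow> weight \<Rightarrow> int" where
  "pairing p q =
     (\<Sum>b\<in>Poly_Mapping.keys p. (if b \<in> \<int> then 1 else -1) * Poly_Mapping.lookup p b * Poly_Mapping.lookup q b)"

definition root_source :: "rat \<Rightarrow> rat" where
  "root_source i = (if i < 0 then i - 1 else if i = 0 then -1 else i)"

definition root_target :: "rat \<Rightarrow> rat" where
  "root_target i = (if i < 0 then i else i + 1/2)"

definition simple_root :: "rat \<Rightarrow> weight" where
  "simple_root i = frag_of (root_source i) - frag_of (root_target i)"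

definition isotropic :: "rat \<Rightarrow> bool" where
  "isotropic i \<longleftrightarrow> pairing (simple_root i) (simple_root i) = 0"

definition weight_ge :: "nat \<Rightarrow> weight \<Rightarrow> weight \<Rightarrow> bool" where
  "weight_ge m p q \<longleftrightarrow>
     (\<exists>c :: rat \<Rightarrow>\<^sub>0 nat. Poly_Mapping.keys c \<subseteq> indices m \<and>
        p - q = (\<Sum>i\<in>Poly_Mapping.keys c. frag_cmul (int (Poly_Mapping.lookup c i)) (simple_root i)))"


section \<open>Crystals\<close>

text \<open>
  The operators \<open>e\<^sub>i\<close>, \<open>f\<^sub>i\<close> are option-valued, \<open>None\<close> being the formal symbol \<open>\<zero>\<close>. That they map
  the underlying set \<open>elems\<close> to itself together with \<open>\<zero>\<close> is part of the predicate \<open>is_crystal\<close>.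
\<close>

record 'a crystal =
  elems :: "'a set"
  cwt :: "'a \<Rightarrow> weight"
  ceps :: "rat \<Rightarrow> 'a \<Rightarrow> nat"
  cphi :: "rat \<Rightarrow> 'a \<Rightarrow> nat"
  ce :: "rat \<Rightarrow> 'a \<Rightarrow> 'a option"
  cf :: "rat \<Rightarrow> 'a \<Rightarrow> 'a option"

definition is_crystal :: "nat \<Rightarrow> 'a crystal \<Rightarrow> bool" where
  "is_crystal m B \<longleftrightarrow>
     (\<forall>b\<in>elems B. cwt B b \<in> weights m) \<and>
     (\<forall>i\<in>indices m. \<forall>b\<in>elems B.
        ce B i b \<in> insert None (Some ` elems B) \<and>
        cf B i b \<in> insert None (Some ` elems B) \<and>
        (isotropic i \<longrightarrow>
           cphi B i b + ceps B i b = (if pairing (cwt B b) (simple_root i) \<noteq> 0 then 1 else 0)) \<and>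
        (\<not> isotropic i \<longrightarrow>
           int (cphi B i b) - int (ceps B i b) = pairing (cwt B b) (simple_root i)) \<and>
        (\<forall>b'. ce B i b = Some b' \<longrightarrow>
           int (ceps B i b') = int (ceps B i b) - 1 \<and>
           int (cphi B i b') = int (cphi B i b) + 1 \<and>
           cwt B b' = cwt B b + simple_root i) \<and>
        (\<forall>b'. cf B i b = Some b' \<longrightarrow>
           int (ceps B i b') = int (ceps B i b) + 1 \<and>
           int (cphi B i b') = int (cphi B i b) - 1 \<and>
           cwt B b' = cwt B b - simple_root i) \<and>
        (\<forall>b'\<in>elems B. cf B i b = Some b' \<longleftrightarrow> ce B i b' = Some b))"

text \<open>\<open>f_string B [i\<^sub>1, \<dots>, i\<^sub>r] b\<close> is \<open>f\<^bsub>i\<^sub>1\<^esub> \<cdots> f\<^bsub>i\<^sub>r\<^esub> b\<close>, where \<open>f\<^sub>i \<zero> = \<zero>\<close>.\<close>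

definition f_string :: "'a crystal \<Rightarrow> rat list \<Rightarrow> 'a \<Rightarrow> 'a option" where
  "f_string B ks b = foldr (\<lambda>i x. Option.bind x (cf B i)) ks (Some b)"

definition crystal_edges :: "nat \<Rightarrow> 'a crystal \<Rightarrow> ('a \<times> 'a) set" where
  "crystal_edges m B =
     {(b, b'). b \<in> elems B \<and> b' \<in> elems B \<and> (\<exists>i\<in>indices m. cf B i b = Some b')}"

definition crystal_connected :: "nat \<Rightarrow> 'a crystal \<Rightarrow> bool" where
  "crystal_connected m B \<longleftrightarrow>
     elems B \<noteq> {} \<and>
     (\<forall>b\<in>elems B. \<forall>b'\<in>elems B. (b, b') \<in> (crystal_edges m B \<union> (crystal_edges m B)\<inverse>)\<^sup>*)"

definition highest_weight_elems :: "nat \<Rightarrow> 'a crystal \<Rightarrow> 'a set" where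
  "highest_weight_elems m B = {h\<in>elems B. \<forall>b\<in>elems B. weight_ge m (cwt B h) (cwt B b)}"


section \<open>Letters, tensor products and words\<close>

definition letter_crystal :: "nat \<Rightarrow> rat crystal" where
  "letter_crystal m =
     \<lparr> elems = letters m,
       cwt = frag_of,
       ceps = (\<lambda>i b. if b = root_target i then 1 else 0),
       cphi = (\<lambda>i b. if b = root_source i then 1 else 0),
       ce = (\<lambda>i b. if b = root_target i then Some (root_source i) else None),
       cf = (\<lambda>i b. if b = root_source i then Some (root_target i) else None) \<rparr>"

lemma root_source_neq_target: "root_source i \<noteq> root_target i"
  by (auto simp: root_source_def root_target_def)

lemma simple_root_eq_iff:
  "simple_root i = frag_of b - frag_of b' \<longleftrightarrow> b = root_source i \<and> b' = root_target i"
proof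
  assume "simple_root i = frag_of b - frag_of b'"
  then have *: "Poly_Mapping.lookup (simple_root i) x = Poly_Mapping.lookup (frag_of b - frag_of b') x" for x
    by simp
  show "b = root_source i \<and> b' = root_target i"
    using *[of "root_source i"] *[of "root_target i"] root_source_neq_target[of i]
    by (auto simp: simple_root_def lookup_minus split: if_splits)
qed (simp add: simple_root_def)

lemma letter_crystal_f_iff:
  "cf (letter_crystal m) i b = Some b' \<longleftrightarrow> simple_root i = frag_of b - frag_of b'"
  by (auto simp: letter_crystal_def simple_root_eq_iff)

lemma letter_crystal_e_iff:
  "ce (letter_crystal m) i b' = Some b \<longleftrightarrow> cf (letter_crystal m) i b = Some b'"
  by (auto simp: letter_crystal_def)

lemma letter_crystal_eps_phi:
  "ceps (letter_crystal m) i b = (if ce (letter_crystal m) i b \<noteq> None then 1 else 0)"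
  "cphi (letter_crystal m) i b = (if cf (letter_crystal m) i b \<noteq> None then 1 else 0)"
  by (auto simp: letter_crystal_def)

text \<open>For \<open>i \<ge> 0\<close>: do \<open>e\<^sub>i\<close> and \<open>f\<^sub>i\<close> act on the first tensor factor?\<close>

definition isotropic_acts_left :: "rat \<Rightarrow> weight \<Rightarrow> weight \<Rightarrow> bool" where
  "isotropic_acts_left i p1 p2 \<longleftrightarrow>
     (if i \<in> \<int> then pairing (simple_root i) p1 \<noteq> 0 else pairing (simple_root i) p2 = 0)"

definition tensor :: "'a crystal \<Rightarrow> 'b crystal \<Rightarrow> ('a \<times> 'b) crystal" where
  "tensor B1 B2 =
     \<lparr> elems = elems B1 \<times> elems B2,
       cwt = (\<lambda>(b1, b2). cwt B1 b1 + cwt B2 b2),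
       ceps = (\<lambda>i (b1, b2).
         if i < 0 then
           nat (max (int (ceps B1 i b1)) (int (ceps B2 i b2) - pairing (simple_root i) (cwt B1 b1)))
         else if isotropic_acts_left i (cwt B1 b1) (cwt B2 b2) then ceps B1 i b1
         else ceps B2 i b2),
       cphi = (\<lambda>i (b1, b2).
         if i < 0 then
           nat (max (int (cphi B1 i b1) + pairing (simple_root i) (cwt B2 b2)) (int (cphi B2 i b2)))
         else if isotropic_acts_left i (cwt B1 b1) (cwt B2 b2) then cphi B1 i b1
         else cphi B2 i b2),
       ce = (\<lambda>i (b1, b2).
         if (if i < 0 then cphi B1 i b1 \<ge> ceps B2 i b2
             else isotropic_acts_left i (cwt B1 b1) (cwt B2 b2))
         then map_option (\<lambda>b. (b, b2)) (ce B1 i b1)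
         else map_option (\<lambda>b. (b1, b)) (ce B2 i b2)),
       cf = (\<lambda>i (b1, b2).
         if (if i < 0 then cphi B1 i b1 > ceps B2 i b2
             else isotropic_acts_left i (cwt B1 b1) (cwt B2 b2))
         then map_option (\<lambda>b. (b, b2)) (cf B1 i b1)
         else map_option (\<lambda>b. (b1, b)) (cf B2 i b2)) \<rparr>"

text \<open>
  Transport of a crystal structure to the set \<open>X\<close>: an element \<open>x\<close> of \<open>X\<close> is identified with \<open>to x\<close>,
  and \<open>from\<close> is the inverse identification.
\<close>

definition transport :: "'b set \<Rightarrow> ('b \<Rightarrow> 'a) \<Rightarrow> ('a \<Rightarrow> 'b) \<Rightarrow> 'a crystal \<Rightarrow> 'b crystal" where
  "transport X to from B =
     \<lparr> elems = X,
       cwt = (\<lambda>x. cwt B (to x)),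
       ceps = (\<lambda>i x. ceps B i (to x)),
       cphi = (\<lambda>i x. cphi B i (to x)),
       ce = (\<lambda>i x. map_option from (ce B i (to x))),
       cf = (\<lambda>i x. map_option from (cf B i (to x))) \<rparr>"

text \<open>
  Words of length \<open>n\<close>. The tensor product is bracketed to the right; it is associative in the
  situation at hand.
\<close>

primrec word_crystal_length :: "nat \<Rightarrow> nat \<Rightarrow> rat list crystal" where
  "word_crystal_length m 0 =
     \<lparr> elems = {[]}, cwt = (\<lambda>_. 0), ceps = (\<lambda>_ _. 0), cphi = (\<lambda>_ _. 0),
       ce = (\<lambda>_ _. None), cf = (\<lambda>_ _. None) \<rparr>"
| "word_crystal_length m (Suc n) =
     transport {w \<in> lists (letters m). length w = Suc n} (\<lambda>w. (hd w, tl w)) (\<lambda>(b, w). b # w)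
       (tensor (letter_crystal m) (word_crystal_length m n))"

definition word_crystal :: "nat \<Rightarrow> rat list crystal" where
  "word_crystal m =
     \<lparr> elems = lists (letters m),
       cwt = (\<lambda>w. cwt (word_crystal_length m (length w)) w),
       ceps = (\<lambda>i w. ceps (word_crystal_length m (length w)) i w),
       cphi = (\<lambda>i w. cphi (word_crystal_length m (length w)) i w),
       ce = (\<lambda>i w. ce (word_crystal_length m (length w)) i w),
       cf = (\<lambda>i w. cf (word_crystal_length m (length w)) i w) \<rparr>"


section \<open>Shapes, diagrams and tableaux\<close>

text \<open>
  The partition is a list of length exactly \<open>m\<close>, padded with zeros; \<open>lam ! (m - 1)\<close> is its \<open>m\<close>-th part.
\<close>

definition shapes :: "nat \<Rightarrow> (nat list \<times> nat list) set" where
  "shapes m =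
     {(lam, \<alpha>). length lam = m \<and> sorted_wrt (\<ge>) lam \<and> (\<forall>a\<in>set \<alpha>. a > 0) \<and>
        (\<alpha> \<noteq> [] \<longrightarrow> m = 0 \<or> lam ! (m - 1) \<noteq> 0)}"

text \<open>
  Nodes are pairs (row, column), counted from 0, rows downwards. The tail occupies the rows from
  \<open>m = length lam\<close> on; each of its rows starts in the column in which the previous one ends, and
  the first one starts in column 0. So the joint is the node \<open>(length lam, 0)\<close>.
\<close>

definition body :: "nat list \<Rightarrow> (nat \<times> nat) set" where
  "body lam = {(r, c). r < length lam \<and> c < lam ! r}"

definition tail_col :: "nat list \<Rightarrow> nat \<Rightarrow> nat" where
  "tail_col \<alpha> k = (\<Sum>j<k. \<alpha> ! j - 1)"

definition ribbon :: "nat list \<Rightarrow> nat list \<Rightarrow> (nat \<times> nat) set" where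
  "ribbon lam \<alpha> = {(length lam + k, tail_col \<alpha> k + j) | k j. k < length \<alpha> \<and> j < \<alpha> ! k}"

definition diagram :: "nat list \<Rightarrow> nat list \<Rightarrow> (nat \<times> nat) set" where
  "diagram lam \<alpha> = body lam \<union> ribbon lam \<alpha>"

type_synonym filling = "nat \<times> nat \<Rightarrow> rat"

definition semistandard :: "(nat \<times> nat) set \<Rightarrow> filling \<Rightarrow> bool" where
  "semistandard D T \<longleftrightarrow>
     (\<forall>r c c'. (r, c) \<in> D \<and> (r, c') \<in> D \<and> c < c' \<longrightarrow>
        T (r, c) \<le> T (r, c') \<and> (T (r, c) \<notin> \<int> \<longrightarrow> T (r, c) \<noteq> T (r, c'))) \<and>
     (\<forall>r r' c. (r, c) \<in> D \<and> (r', c) \<in> D \<and> r < r' \<longrightarrow>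
        T (r, c) \<le> T (r', c) \<and> (T (r, c) \<in> \<int> \<longrightarrow> T (r, c) \<noteq> T (r', c)))"

definition tableaux :: "nat \<Rightarrow> nat list \<Rightarrow> nat list \<Rightarrow> filling set" where
  "tableaux m lam \<alpha> =
     {T \<in> diagram lam \<alpha> \<rightarrow>\<^sub>E letters m.
        semistandard (diagram lam \<alpha>) T \<and>
        (\<alpha> \<noteq> [] \<longrightarrow>
          (let b = T (length lam, 0) in
             (b \<in> \<int> \<and> 0 < b \<longrightarrow> (\<forall>x\<in>body lam. T x < b)) \<and>
             (b \<notin> \<int> \<longrightarrow> (\<forall>x\<in>body lam. T x \<le> b))))}"

definition reading_order :: "nat list \<Rightarrow> nat list \<Rightarrow> (nat \<times> nat) list" where
  "reading_order lam \<alpha> =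
     concat (map (\<lambda>r. map (\<lambda>c. (r, c)) (rev [0..<lam ! r])) [0..<length lam]) @
     concat (map (\<lambda>k. map (\<lambda>j. (length lam + k, tail_col \<alpha> k + j)) (rev [0..<\<alpha> ! k])) [0..<length \<alpha>])"

definition reading_word :: "nat list \<Rightarrow> nat list \<Rightarrow> filling \<Rightarrow> rat list" where
  "reading_word lam \<alpha> T = map T (reading_order lam \<alpha>)"

text \<open>
  The filling, not necessarily a semistandard one, with the given reading word. Thus it is a
  genuine assertion that the operators of \<open>tableau_crystal\<close> stay within \<open>tableaux m lam \<alpha>\<close>.
\<close>

definition filling_of_word :: "nat list \<Rightarrow> nat list \<Rightarrow> rat list \<Rightarrow> filling" where
  "filling_of_word lam \<alpha> w = (THE T. T \<in> extensional (diagram lam \<alpha>) \<and> reading_word lam \<alpha> T = w)"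

definition tableau_crystal :: "nat \<Rightarrow> nat list \<Rightarrow> nat list \<Rightarrow> filling crystal" where
  "tableau_crystal m lam \<alpha> =
     transport (tableaux m lam \<alpha>) (reading_word lam \<alpha>) (filling_of_word lam \<alpha>) (word_crystal m)"


section \<open>The tableau \<open>H\<close>\<close>

text \<open>\<open>tail_entry \<alpha> k j\<close> is the entry of \<open>H\<^sub>\<alpha>\<close> in the \<open>j\<close>-th node of the \<open>k\<close>-th row (counted from 0).\<close>

fun tail_entry :: "nat list \<Rightarrow> nat \<Rightarrow> nat \<Rightarrow> rat" where
  "tail_entry \<alpha> 0 0 = 1/2"
| "tail_entry \<alpha> k (Suc j) =
     (let x = tail_entry \<alpha> k j in if x \<in> \<int> then x else x + 1/2)"
| "tail_entry \<alpha> (Suc k) 0 =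
     (let x = tail_entry \<alpha> k (\<alpha> ! k - 1) in if x \<notin> \<int> then x else x + 1/2)"

definition highest_tableau :: "nat list \<Rightarrow> nat list \<Rightarrow> filling" where
  "highest_tableau lam \<alpha> = (\<lambda>(r, c).
     if (r, c) \<in> body lam then of_nat r - of_nat (length lam)
     else if (r, c) \<in> ribbon lam \<alpha> then
       tail_entry \<alpha> (r - length lam) (c - tail_col \<alpha> (r - length lam))
     else undefined)"

end

theory Submission
  imports Defs
begin

text \<open>
  On words, \<open>e\<^sub>i\<close> and \<open>f\<^sub>i\<close> replace a single letter, whose position is determined by the rest of the
  word: for \<open>i \<ge> 0\<close> it is the first (\<open>i\<close> an integer) or the last (otherwise) occurrence of one of the
  two letters involved, and for \<open>i < 0\<close> it is given by the signature rule. This makes \<open>e\<^sub>i\<close> and \<open>f\<^sub>i\<close>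
  mutually inverse, and at that position the neighbouring entries of a tableau leave room for the
  change, so that tableaux are closed under the operators.

  If all \<open>e\<^sub>i\<close> vanish on a tableau, then its negative entries are those of the highest weight
  tableau, because the first wrong one could be raised. If there are positive entries, then \<open>1/2\<close>
  occurs, since the smallest one could be raised otherwise; the vanishing of \<open>e\<^sub>0\<close> then forces every
  \<open>1/2\<close> out of the body, so the joint is \<open>1/2\<close> and the body is negative. Along the tail the entries
  have no gaps, and they increase only where semistandardness forces them to, for otherwise the
  larger entry could be raised. So the highest weight tableau is the only source, and it generates
  the crystal since every \<open>e\<^sub>i\<close> decreases the sum of the entries.
\<close>

section \<open>Words and the signature rule\<close>

text \<open>For \<open>i \<ge> 0\<close> the two letters of a simple root have opposite parity, and
  the tensor rule is fitted to this. Let \<open>f\<^sub>i\<close> act at a node \<open>x\<close>. If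
  \<open>i\<close> is an integer, the old entry is even and the new one odd: columns already force
  the entry below to exceed the old one, which is all that an odd entry demands, while entries to
  the right are read before \<open>x\<close>, where the rule of the first occurrence excludes both
  letters. If \<open>i\<close> is a half-integer, rows and columns, and first and last, exchange
  their roles. For \<open>e\<^sub>i\<close> the same happens on the left and above. So strictness
  protects one direction and the reading order the other. For \<open>i < 0\<close> both letters are
  even, strictness helps only in columns, and what is missing comes from counting cancelled letters.
  The body meets the tail geometrically only in column 0. The conditions on the joint make it behave
  as if it stood below every node of the body; as the whole body is read before the joint, the same
  parity argument covers a body node and the joint.\<close>

lemma letters_double_Ints: "b \<in> letters m \<Longrightarrow> 2 * b \<in> \<int>"
  unfolding letters_def by auto

lemma indices_double_Ints: "i \<in> indices m \<Longrightarrow> 2 * i \<in> \<int>"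
  unfolding indices_def by auto

lemma indices_neg:
  "i \<in> indices m \<Longrightarrow> i < 0 \<Longrightarrow> i \<in> \<int> \<and> - of_nat m + 1 \<le> i \<and> i \<le> -1"
  unfolding indices_def by auto

lemma half_Ints_cases:
  fixes x :: rat
  assumes "2 * x \<in> \<int>" "x \<notin> \<int>"
  obtains k :: int where "x = of_int k + 1/2"
proof -
  obtain n where n: "2 * x = of_int n" using assms(1) by (auto elim: Ints_cases)
  have "odd n"
  proof
    assume "even n"
    then obtain k where "n = 2 * k" by blast
    then have "x = of_int k" using n by simp
    then show False using assms(2) by simp
  qed
  then obtain k where "n = 2 * k + 1" by (auto elim: oddE)
  then have "x = of_int k + 1/2" using n by simp
  then show thesis by (rule that)
qed

lemma not_Ints_add_half: "(x :: rat) \<in> \<int> \<Longrightarrow> x + 1/2 \<notin> \<int>"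
proof
  assume "x \<in> \<int>" "x + 1/2 \<in> \<int>"
  then have "(x + 1/2) - x \<in> \<int>" by (rule Ints_diff[rotated])
  then obtain k :: int where "(1/2 :: rat) = of_int k" by (auto elim: Ints_cases)
  then have "of_int (2 * k) = (1 :: rat)" by simp
  then have "2 * k = 1" by (metis of_int_eq_1_iff)
  then show False by presburger
qed

lemma Ints_add_half:
  fixes x :: rat
  assumes "2 * x \<in> \<int>"
  shows "x + 1/2 \<in> \<int> \<longleftrightarrow> x \<notin> \<int>"
proof (cases "x \<in> \<int>")
  case False
  then obtain k where "x = of_int k + 1/2" using assms half_Ints_cases by blast
  then have "x + 1/2 = of_int (k + 1)" by simp
  then show ?thesis using False by (metis Ints_of_int)
qed (use not_Ints_add_half in auto)

lemma double_Ints_less_iff: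
  fixes x y :: rat
  assumes "2 * x \<in> \<int>" "2 * y \<in> \<int>"
  shows "x < y \<longleftrightarrow> x + 1/2 \<le> y"
proof -
  obtain k l where "2 * x = of_int k" "2 * y = of_int l" using assms by (auto elim!: Ints_cases)
  moreover have "(of_int k :: rat) < of_int l \<longleftrightarrow> of_int k + 1 \<le> (of_int l :: rat)"
    by (metis add1_zle_eq of_int_1 of_int_add of_int_le_iff of_int_less_iff)
  ultimately show ?thesis by linarith
qed

lemma Ints_less_iff:
  fixes x y :: rat
  assumes "x \<in> \<int>" "y \<in> \<int>"
  shows "x < y \<longleftrightarrow> x + 1 \<le> y"
proof -
  obtain k l :: int where "x = of_int k" "y = of_int l" using assms by (auto elim!: Ints_cases)
  then show ?thesis by (metis add1_zle_eq of_int_1 of_int_add of_int_le_iff of_int_less_iff)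
qed

lemma letters_neg: "b \<in> letters m \<Longrightarrow> b \<le> 0 \<Longrightarrow> b \<in> \<int> \<and> - of_nat m \<le> b \<and> b \<le> -1"
  unfolding letters_def by auto

lemma letters_pos_ge: "b \<in> letters m \<Longrightarrow> 0 < b \<Longrightarrow> 1/2 \<le> b"
  using double_Ints_less_iff[of 0 b] letters_double_Ints[of b m] by simp

lemma letters_posI: "2 * b \<in> \<int> \<Longrightarrow> 0 < b \<Longrightarrow> b \<in> letters m"
  unfolding letters_def by simp

lemma root_source_mem: "i \<in> indices m \<Longrightarrow> root_source i \<in> letters m"
  unfolding indices_def letters_def root_source_def by auto

lemma root_target_mem: "i \<in> indices m \<Longrightarrow> root_target i \<in> letters m"
  unfolding indices_def letters_def root_target_def by (auto simp: distrib_left)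

lemma root_source_less_target: "root_source i < root_target i"
  by (auto simp: root_source_def root_target_def)

lemma root_source_less_half: "root_source i + 1/2 \<le> root_target i"
  by (auto simp: root_source_def root_target_def)

lemma root_parity:
  assumes "i \<in> indices m"
  shows "i < 0 \<Longrightarrow> root_source i \<in> \<int>" "i < 0 \<Longrightarrow> root_target i \<in> \<int>"
    and "0 \<le> i \<Longrightarrow> root_source i \<in> \<int> \<longleftrightarrow> i \<in> \<int>"
    and "0 \<le> i \<Longrightarrow> root_target i \<in> \<int> \<longleftrightarrow> i \<notin> \<int>"
  using indices_double_Ints[OF assms] indices_neg[OF assms] Ints_add_half[of i]
  by (auto simp: root_source_def root_target_def)

section \<open>The pairing with a simple root\<close>

lemma pairing_superset:
  assumes "finite A" "Poly_Mapping.keys p \<subseteq> A"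
  shows "pairing p q =
    (\<Sum>b\<in>A. (if b \<in> \<int> then 1 else -1) * Poly_Mapping.lookup p b * Poly_Mapping.lookup q b)"
  unfolding pairing_def
  by (rule sum.mono_neutral_left) (use assms in \<open>auto simp: in_keys_iff\<close>)

lemma pairing_commute: "pairing p q = pairing q p"
  using pairing_superset[of "Poly_Mapping.keys p \<union> Poly_Mapping.keys q" p q]
    pairing_superset[of "Poly_Mapping.keys p \<union> Poly_Mapping.keys q" q p]
  by (simp add: mult_ac)

lemma lookup_simple_root:
  "Poly_Mapping.lookup (simple_root i) x =
    (if x = root_source i then 1 else if x = root_target i then -1 else 0)"
  using root_source_neq_target[of i] by (auto simp: simple_root_def lookup_minus)

lemma pairing_simple_root:
  "pairing (simple_root i) q =
    (if root_source i \<in> \<int> then 1 else -1) * Poly_Mapping.lookup q (root_source i) -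
    (if root_target i \<in> \<int> then 1 else -1) * Poly_Mapping.lookup q (root_target i)"
proof -
  have "Poly_Mapping.keys (simple_root i) \<subseteq> {root_source i, root_target i}"
    by (auto simp: in_keys_iff lookup_simple_root split: if_splits)
  then show ?thesis
    using root_source_neq_target[of i]
    by (subst pairing_superset[of "{root_source i, root_target i}"]) (auto simp: lookup_simple_root)
qed

lemma pairing_neg_root:
  assumes "i \<in> indices m" "i < 0"
  shows "pairing (simple_root i) q =
    Poly_Mapping.lookup q (root_source i) - Poly_Mapping.lookup q (root_target i)"
  using root_parity[OF assms(1)] assms(2) by (simp add: pairing_simple_root)

text \<open>Opposite parity turns the difference of the two coefficients into a sum up to sign. For
  the weight of a word, whose coefficients are counts, nothing can cancel.\<close>

lemma pairing_nonneg_root: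
  assumes "i \<in> indices m" "0 \<le> i"
  shows "pairing (simple_root i) q = (if i \<in> \<int> then 1 else -1) *
    (Poly_Mapping.lookup q (root_source i) + Poly_Mapping.lookup q (root_target i))"
  using root_parity[OF assms(1)] assms(2) by (simp add: pairing_simple_root)

lemma isotropic_iff: "i \<in> indices m \<Longrightarrow> isotropic i \<longleftrightarrow> 0 \<le> i"
  unfolding isotropic_def using root_source_neq_target[of i]
  by (cases "0 \<le> i") (auto simp: pairing_neg_root pairing_nonneg_root lookup_simple_root)

section \<open>Recursion of the crystal data over words\<close>

lemma word_crystal_Nil [simp]:
  "cwt (word_crystal m) [] = 0" "ceps (word_crystal m) i [] = 0" "cphi (word_crystal m) i [] = 0"
  "ce (word_crystal m) i [] = None" "cf (word_crystal m) i [] = None"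
  by (simp_all add: word_crystal_def)

lemma cwt_Cons [simp]: "cwt (word_crystal m) (b # w) = frag_of b + cwt (word_crystal m) w"
  by (simp add: word_crystal_def transport_def tensor_def letter_crystal_def)

lemma cwt_append [simp]:
  "cwt (word_crystal m) (u @ v) = cwt (word_crystal m) u + cwt (word_crystal m) v"
  by (induction u) (simp_all add: add.assoc)

lemma lookup_cwt: "Poly_Mapping.lookup (cwt (word_crystal m) w) b = int (count_list w b)"
  by (induction w) (auto simp: lookup_add)

lemma keys_cwt: "Poly_Mapping.keys (cwt (word_crystal m) w) = set w"
  by (auto simp: in_keys_iff lookup_cwt count_list_0_iff)

lemma lookup_frag_of: "Poly_Mapping.lookup (frag_of b) x = (if x = b then 1 else 0 :: int)"
  by simp

context
  fixes m :: nat and i :: rat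
  assumes i: "i \<in> indices m"
begin

text \<open>The truncated \<open>- 1\<close> is the maximum in the tensor rule: a letter
  \<open>root_source i\<close> has \<open>ceps\<close> equal to 0 and lowers the contribution of
  \<open>w\<close> by its pairing 1.\<close>

lemma eps_Cons_neg:
  assumes "i < 0"
  shows "ceps (word_crystal m) i (b # w) =
    (if b = root_target i then Suc (ceps (word_crystal m) i w)
     else if b = root_source i then ceps (word_crystal m) i w - 1
     else ceps (word_crystal m) i w)"
  using root_source_neq_target[of i] assms
  by (auto simp: word_crystal_def transport_def tensor_def letter_crystal_def
      pairing_neg_root[OF i] lookup_frag_of)

lemma f_Cons_neg:
  assumes "i < 0"
  shows "cf (word_crystal m) i (b # w) =
    (if b = root_source i \<and> ceps (word_crystal m) i w = 0 then Some (root_target i # w)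
     else map_option ((#) b) (cf (word_crystal m) i w))"
  using root_source_neq_target[of i] assms
  by (auto simp: word_crystal_def transport_def tensor_def letter_crystal_def option.map_comp o_def)

lemma e_Cons_neg:
  assumes "i < 0"
  shows "ce (word_crystal m) i (b # w) =
    (if ceps (word_crystal m) i w \<le> (if b = root_source i then 1 else 0)
     then (if b = root_target i then Some (root_source i # w) else None)
     else map_option ((#) b) (ce (word_crystal m) i w))"
  using root_source_neq_target[of i] assms
  by (auto simp: word_crystal_def transport_def tensor_def letter_crystal_def option.map_comp o_def)

text \<open>Adding the pairing with the total weight to both entries of the maximum that defines
  \<open>ceps\<close> of a tensor product gives the two entries of the maximum for
  \<open>cphi\<close>.\<close>

lemma phi_minus_eps_neg:
  assumes "i < 0"
  shows "int (cphi (word_crystal m) i w) - int (ceps (word_crystal m) i w) =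
    pairing (simple_root i) (cwt (word_crystal m) w)"
proof (induction w)
  case (Cons b w)
  have "int (cphi (word_crystal m) i (b # w)) =
    max ((if b = root_source i then 1 else 0) + pairing (simple_root i) (cwt (word_crystal m) w))
      (int (cphi (word_crystal m) i w))"
    using assms
    by (simp add: word_crystal_def transport_def tensor_def letter_crystal_def le_max_iff_disj)
  moreover have "pairing (simple_root i) (cwt (word_crystal m) (b # w)) =
    (if b = root_source i then 1 else if b = root_target i then -1 else 0) +
      pairing (simple_root i) (cwt (word_crystal m) w)"
    using root_source_neq_target[of i] assms
    by (auto simp: pairing_neg_root[OF i] lookup_frag_of lookup_add)
  ultimately show ?case
    using Cons.IH root_source_neq_target[of i] by (auto simp: eps_Cons_neg[OF assms])
qed (simp add: pairing_neg_root[OF i assms])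

text \<open>Together with \<open>eps_attained\<close> this replaces the recursion by a closed form:
  \<open>ceps\<close> is the largest excess of \<open>root_target i\<close> over
  \<open>root_source i\<close> in a prefix, the empty one included.\<close>

lemma eps_ge_prefix:
  assumes "i < 0"
  shows "int (count_list p (root_target i)) - int (count_list p (root_source i)) \<le>
    int (ceps (word_crystal m) i (p @ q))"
  using root_source_neq_target[of i]
  by (induction p) (auto simp: eps_Cons_neg[OF assms])

lemma eps_attained:
  assumes "i < 0"
  shows "\<exists>p q. w = p @ q \<and>
    int (ceps (word_crystal m) i w) =
      int (count_list p (root_target i)) - int (count_list p (root_source i))"
proof (induction w)
  case (Cons b w)
  then obtain p q where pq: "w = p @ q" "int (ceps (word_crystal m) i w) =
      int (count_list p (root_target i)) - int (count_list p (root_source i))" by blast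
  show ?case
  proof (cases "b = root_source i \<and> ceps (word_crystal m) i w = 0")
    \<comment> \<open>Here the recursion truncates at 0, a value that the empty prefix
      attains.\<close>
    case True
    then show ?thesis
      using root_source_neq_target[of i]
      by (intro exI[of _ "[]"] exI[of _ "b # w"]) (simp add: eps_Cons_neg[OF assms])
  next
    case False
    then show ?thesis
      using pq root_source_neq_target[of i]
      by (intro exI[of _ "b # p"] exI[of _ q]) (auto simp: eps_Cons_neg[OF assms])
  qed
qed simp

lemma eps_append_eq:
  assumes "i < 0" "root_source i \<notin> set u" "root_target i \<notin> set u"
  shows "ceps (word_crystal m) i (u @ v) = ceps (word_crystal m) i v"
  using assms(2,3) by (induction u) (auto simp: eps_Cons_neg[OF assms(1)])

text \<open>Used in the contrapositive: a positive \<open>ceps\<close> is enough to know that some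
  letter can be raised, without locating it.\<close>

lemma e_eq_None_imp_eps_eq_0:
  assumes "i < 0"
  shows "ce (word_crystal m) i w = None \<Longrightarrow> ceps (word_crystal m) i w = 0"
  by (induction w) (auto simp: eps_Cons_neg[OF assms] e_Cons_neg[OF assms] split: if_splits)

lemma pairing_cwt_eq_0_iff:
  assumes "0 \<le> i"
  shows "pairing (simple_root i) (cwt (word_crystal m) w) = 0 \<longleftrightarrow>
    root_source i \<notin> set w \<and> root_target i \<notin> set w"
proof -
  have "pairing (simple_root i) (cwt (word_crystal m) w) = 0 \<longleftrightarrow>
      int (count_list w (root_source i)) + int (count_list w (root_target i)) = 0"
    unfolding pairing_nonneg_root[OF i assms] lookup_cwt by (simp only: mult_eq_0_iff) simp
  also have "\<dots> \<longleftrightarrow> root_source i \<notin> set w \<and> root_target i \<notin> set w"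
    using count_list_0_iff[of w "root_source i"] count_list_0_iff[of w "root_target i"] by linarith
  finally show ?thesis .
qed

lemma isotropic_acts_left_words:
  assumes "0 \<le> i"
  shows "isotropic_acts_left i (cwt (word_crystal m) u) (cwt (word_crystal m) v) \<longleftrightarrow>
    (if i \<in> \<int> then root_source i \<in> set u \<or> root_target i \<in> set u
     else root_source i \<notin> set v \<and> root_target i \<notin> set v)"
  unfolding isotropic_acts_left_def pairing_cwt_eq_0_iff[OF assms] by simp

text \<open>The negation of \<open>isotropic_acts_left\<close> for the letter \<open>b\<close> and
  the word \<open>w\<close>: the operators pass over \<open>b\<close>. An integer \<open>i\<close>
  looks at \<open>b\<close>, a half-integer at \<open>w\<close>, whence the first and the last
  occurrence.\<close>

definition head_inert :: "rat \<Rightarrow> rat list \<Rightarrow> bool" where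
  "head_inert b w \<longleftrightarrow>
    (if i \<in> \<int> then b \<noteq> root_source i \<and> b \<noteq> root_target i
     else root_source i \<in> set w \<or> root_target i \<in> set w)"

lemma isotropic_Cons:
  assumes "0 \<le> i"
  shows "ceps (word_crystal m) i (b # w) =
      (if head_inert b w then ceps (word_crystal m) i w else if b = root_target i then 1 else 0)"
    and "cphi (word_crystal m) i (b # w) =
      (if head_inert b w then cphi (word_crystal m) i w else if b = root_source i then 1 else 0)"
    and "ce (word_crystal m) i (b # w) =
      (if head_inert b w then map_option ((#) b) (ce (word_crystal m) i w)
       else if b = root_target i then Some (root_source i # w) else None)"
    and "cf (word_crystal m) i (b # w) =
      (if head_inert b w then map_option ((#) b) (cf (word_crystal m) i w)
       else if b = root_source i then Some (root_target i # w) else None)"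
proof -
  \<comment> \<open>Phrased with \<open>word_crystal_length\<close>, because unfolding the word
    crystal leaves the weight of the right factor in this form.\<close>
  have *: "isotropic_acts_left i (frag_of b) (cwt (word_crystal_length m (length w)) w) \<longleftrightarrow>
      \<not> head_inert b w"
    using isotropic_acts_left_words[OF assms, of "[b]" w]
    by (auto simp: head_inert_def word_crystal_def transport_def tensor_def letter_crystal_def)
  show "ceps (word_crystal m) i (b # w) =
      (if head_inert b w then ceps (word_crystal m) i w else if b = root_target i then 1 else 0)"
    "cphi (word_crystal m) i (b # w) =
      (if head_inert b w then cphi (word_crystal m) i w else if b = root_source i then 1 else 0)"
    "ce (word_crystal m) i (b # w) =
      (if head_inert b w then map_option ((#) b) (ce (word_crystal m) i w)
       else if b = root_target i then Some (root_source i # w) else None)"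
    "cf (word_crystal m) i (b # w) =
      (if head_inert b w then map_option ((#) b) (cf (word_crystal m) i w)
       else if b = root_source i then Some (root_target i # w) else None)"
    using assms *
    by (auto simp: word_crystal_def transport_def tensor_def letter_crystal_def option.map_comp o_def)
qed

lemma isotropic_phi_plus_eps:
  assumes "0 \<le> i"
  shows "cphi (word_crystal m) i w + ceps (word_crystal m) i w =
    (if root_source i \<in> set w \<or> root_target i \<in> set w then 1 else 0)"
  by (induction w) (use root_source_neq_target[of i] in \<open>auto simp: isotropic_Cons[OF assms] head_inert_def\<close>)

end

section \<open>The operators as the change of a single letter\<close>

text \<open>
  The position between \<open>u\<close> and \<open>v\<close> is the one at which the signature rule lets \<open>e\<^sub>i\<close> and \<open>f\<^sub>i\<close> act.
  For \<open>i < 0\<close>, a letter \<open>root_source i\<close> cancels a later letter \<open>root_target i\<close>.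
\<close>

definition acts_at :: "rat \<Rightarrow> rat list \<Rightarrow> rat list \<Rightarrow> bool" where
  "acts_at i u v \<longleftrightarrow>
    (if i < 0 then
       (\<forall>p q. u = p @ q \<longrightarrow> count_list q (root_source i) \<le> count_list q (root_target i)) \<and>
       (\<forall>p q. v = p @ q \<longrightarrow> count_list p (root_target i) \<le> count_list p (root_source i))
     else if i \<in> \<int> then root_source i \<notin> set u \<and> root_target i \<notin> set u
     else root_source i \<notin> set v \<and> root_target i \<notin> set v)"

context
  fixes m :: nat and i :: rat
  assumes i: "i \<in> indices m"
begin

lemma acts_at_Nil_neg:
  assumes "i < 0"
  shows "acts_at i [] v \<longleftrightarrow> ceps (word_crystal m) i v = 0"
proof
  assume "acts_at i [] v"
  moreover obtain p q where "v = p @ q" "int (ceps (word_crystal m) i v) =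
      int (count_list p (root_target i)) - int (count_list p (root_source i))"
    using eps_attained[OF i assms] by blast
  ultimately show "ceps (word_crystal m) i v = 0"
    using assms unfolding acts_at_def by fastforce
next
  assume 0: "ceps (word_crystal m) i v = 0"
  have "count_list p (root_target i) \<le> count_list p (root_source i)" if "v = p @ q" for p q
    using eps_ge_prefix[OF i assms, of p q] 0 that by simp
  then show "acts_at i [] v" using assms by (simp add: acts_at_def)
qed

text \<open>Putting \<open>b\<close> in front creates exactly one new suffix of the left part,
  namely all of \<open>b # u\<close>.\<close>

lemma acts_at_Cons_neg:
  assumes "i < 0"
  shows "acts_at i (b # u) v \<longleftrightarrow> acts_at i u v \<and>
    count_list (b # u) (root_source i) \<le> count_list (b # u) (root_target i)"
  using assms unfolding acts_at_def by (fastforce simp: Cons_eq_append_conv)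

text \<open>The excess of targets is maximal at the marked position: a prefix ending inside
  \<open>u\<close> lacks a suffix of \<open>u\<close> with at least as many targets as sources, and
  one that goes beyond \<open>x\<close> adds a prefix of \<open>v\<close> with at least as many
  sources as targets.\<close>

lemma acts_at_prefix_le:
  assumes "i < 0" "acts_at i u v" "u @ x # v = p @ q"
    and "x = root_source i \<or> x = root_target i"
  shows "int (count_list p (root_target i)) - int (count_list p (root_source i)) \<le>
    int (count_list u (root_target i)) - int (count_list u (root_source i)) +
    (if x = root_target i then 1 else 0)"
proof -
  consider q' where "u = p @ q'" | p' where "p = u @ x # p'" "v = p' @ q"
    using assms(3) by (auto simp: append_eq_append_conv2 Cons_eq_append_conv)
  then show ?thesis
  proof cases
    case 1
    have "\<forall>p q. u = p @ q \<longrightarrow> count_list q (root_source i) \<le> count_list q (root_target i)"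
      using assms(1,2) unfolding acts_at_def by simp
    then have "count_list q' (root_source i) \<le> count_list q' (root_target i)"
      using 1 by blast
    then show ?thesis using 1 by simp
  next
    case 2
    have "\<forall>p q. v = p @ q \<longrightarrow> count_list p (root_target i) \<le> count_list p (root_source i)"
      using assms(1,2) unfolding acts_at_def by simp
    then have "count_list p' (root_target i) \<le> count_list p' (root_source i)"
      using 2 by blast
    then show ?thesis using 2 assms(4) root_source_neq_target[of i] by auto
  qed
qed

lemma acts_at_count:
  assumes "i < 0" "acts_at i u v"
  shows "count_list u (root_source i) \<le> count_list u (root_target i)"
  using assms unfolding acts_at_def by (metis append_Nil)

text \<open>The prefix \<open>u\<close>, extended by \<open>x\<close> if \<open>x\<close> is
  \<open>root_target i\<close>, attains the maximum over all prefixes that \<open>ceps\<close>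
  is.\<close>

lemma eps_acts_at:
  assumes "i < 0" "acts_at i u v"
  shows "x = root_source i \<or> x = root_target i \<Longrightarrow>
    int (ceps (word_crystal m) i (u @ x # v)) =
    int (count_list u (root_target i)) - int (count_list u (root_source i)) +
    (if x = root_target i then 1 else 0)"
proof (rule antisym)
  assume x: "x = root_source i \<or> x = root_target i"
  obtain p q where pq: "u @ x # v = p @ q" "int (ceps (word_crystal m) i (u @ x # v)) =
      int (count_list p (root_target i)) - int (count_list p (root_source i))"
    using eps_attained[OF i assms(1)] by blast
  from pq(2) acts_at_prefix_le[OF assms pq(1) x]
  show "int (ceps (word_crystal m) i (u @ x # v)) \<le>
    int (count_list u (root_target i)) - int (count_list u (root_source i)) +
    (if x = root_target i then 1 else 0)" by simp
next
  show "int (count_list u (root_target i)) - int (count_list u (root_source i)) +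
    (if x = root_target i then 1 else 0) \<le> int (ceps (word_crystal m) i (u @ x # v))"
    using eps_ge_prefix[OF i assms(1), of u "x # v"] eps_ge_prefix[OF i assms(1), of "u @ [x]" v]
      root_source_neq_target[of i]
    by (auto split: if_splits)
qed

lemma f_neg_iff:
  assumes "i < 0"
  shows "cf (word_crystal m) i w = Some w' \<longleftrightarrow>
    (\<exists>u v. w = u @ root_source i # v \<and> w' = u @ root_target i # v \<and> acts_at i u v)"
proof (induction w arbitrary: w')
  case (Cons b w)
  show ?case
  proof
    assume *: "cf (word_crystal m) i (b # w) = Some w'"
    show "\<exists>u v. b # w = u @ root_source i # v \<and> w' = u @ root_target i # v \<and> acts_at i u v"
    proof (cases "b = root_source i \<and> ceps (word_crystal m) i w = 0")
      case True
      then show ?thesis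
        using * by (intro exI[of _ "[]"] exI[of _ w])
          (simp add: f_Cons_neg[OF i assms] acts_at_Nil_neg[OF assms])
    next
      case False
      then obtain w1 where w1: "w' = b # w1" "cf (word_crystal m) i w = Some w1"
        using * by (auto simp: f_Cons_neg[OF i assms] simp del: not_gr_zero)
      then obtain u v where uv: "w = u @ root_source i # v" "w1 = u @ root_target i # v" "acts_at i u v"
        using Cons.IH by blast
      \<comment> \<open>If \<open>b\<close> is \<open>root_source i\<close>, then
        \<open>ceps\<close> of \<open>w\<close> is positive here and equals the excess of targets in
        \<open>u\<close>, so \<open>u\<close> has a target to spare for \<open>b\<close>.\<close>
      have "count_list (b # u) (root_source i) \<le> count_list (b # u) (root_target i)"
        using False acts_at_count[OF assms uv(3)] eps_acts_at[OF assms uv(3), of "root_source i"]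
          root_source_neq_target[of i] uv(1)
        by auto
      then have "acts_at i (b # u) v" using uv(3) by (simp add: acts_at_Cons_neg[OF assms])
      then show ?thesis using uv w1 by (intro exI[of _ "b # u"] exI[of _ v]) simp
    qed
  next
    assume "\<exists>u v. b # w = u @ root_source i # v \<and> w' = u @ root_target i # v \<and> acts_at i u v"
    then obtain u v where uv: "b # w = u @ root_source i # v" "w' = u @ root_target i # v" "acts_at i u v"
      by blast
    show "cf (word_crystal m) i (b # w) = Some w'"
    proof (cases u)
      case Nil
      then show ?thesis using uv by (simp add: f_Cons_neg[OF i assms] acts_at_Nil_neg[OF assms])
    next
      case (Cons b' u')
      then have *: "w = u' @ root_source i # v" "w' = b # u' @ root_target i # v" "acts_at i u' v"
        "count_list (b # u') (root_source i) \<le> count_list (b # u') (root_target i)"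
        using uv by (auto simp: acts_at_Cons_neg[OF assms])
      then have "cf (word_crystal m) i w = Some (u' @ root_target i # v)"
        using Cons.IH by blast
      moreover have "\<not> (b = root_source i \<and> ceps (word_crystal m) i w = 0)"
        using *(4) eps_acts_at[OF assms *(3), of "root_source i"] *(1) root_source_neq_target[of i]
        by auto
      ultimately show ?thesis using * by (auto simp: f_Cons_neg[OF i assms])
    qed
  qed
qed simp

lemma e_neg_iff:
  assumes "i < 0"
  shows "ce (word_crystal m) i w = Some w' \<longleftrightarrow>
    (\<exists>u v. w = u @ root_target i # v \<and> w' = u @ root_source i # v \<and> acts_at i u v)"
proof (induction w arbitrary: w')
  case (Cons b w)
  let ?L = "ceps (word_crystal m) i w \<le> (if b = root_source i then 1 else 0)"
  show ?case
  proof
    assume *: "ce (word_crystal m) i (b # w) = Some w'"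
    show "\<exists>u v. b # w = u @ root_target i # v \<and> w' = u @ root_source i # v \<and> acts_at i u v"
    proof (cases ?L)
      case True
      then have "b = root_target i" "w' = root_source i # w" "ceps (word_crystal m) i w = 0"
        using * root_source_neq_target[of i] by (auto simp: e_Cons_neg[OF i assms] split: if_splits)
      then show ?thesis
        by (intro exI[of _ "[]"] exI[of _ w]) (simp add: acts_at_Nil_neg[OF assms])
    next
      case False
      then obtain w1 where w1: "w' = b # w1" "ce (word_crystal m) i w = Some w1"
        using * by (auto simp: e_Cons_neg[OF i assms] split: if_splits)
      then obtain u v where uv: "w = u @ root_target i # v" "w1 = u @ root_source i # v" "acts_at i u v"
        using Cons.IH by blast
      \<comment> \<open>Now \<open>ceps\<close> of \<open>w\<close> also counts the target at the
        marked position. For \<open>b = root_source i\<close> it exceeds 1, which again leaves a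
        target in \<open>u\<close> to spare for \<open>b\<close>.\<close>
      have "count_list (b # u) (root_source i) \<le> count_list (b # u) (root_target i)"
        using False acts_at_count[OF assms uv(3)] eps_acts_at[OF assms uv(3), of "root_target i"]
          root_source_neq_target[of i] uv(1)
        by auto
      then have "acts_at i (b # u) v" using uv(3) by (simp add: acts_at_Cons_neg[OF assms])
      then show ?thesis using uv w1 by (intro exI[of _ "b # u"] exI[of _ v]) simp
    qed
  next
    assume "\<exists>u v. b # w = u @ root_target i # v \<and> w' = u @ root_source i # v \<and> acts_at i u v"
    then obtain u v where uv: "b # w = u @ root_target i # v" "w' = u @ root_source i # v" "acts_at i u v"
      by blast
    show "ce (word_crystal m) i (b # w) = Some w'"
    proof (cases u)
      case Nil
      then show ?thesis using uv root_source_neq_target[of i]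
        by (simp add: e_Cons_neg[OF i assms] acts_at_Nil_neg[OF assms])
    next
      case (Cons b' u')
      then have *: "w = u' @ root_target i # v" "w' = b # u' @ root_source i # v" "acts_at i u' v"
        "count_list (b # u') (root_source i) \<le> count_list (b # u') (root_target i)"
        using uv by (auto simp: acts_at_Cons_neg[OF assms])
      then have "ce (word_crystal m) i w = Some (u' @ root_source i # v)"
        using Cons.IH by blast
      moreover have "\<not> ?L"
        using *(4) eps_acts_at[OF assms *(3), of "root_target i"] *(1) root_source_neq_target[of i]
          acts_at_count[OF assms *(3)]
        by auto
      ultimately show ?thesis using * by (simp add: e_Cons_neg[OF i assms])
    qed
  qed
qed simp

text \<open>Kept abstract in \<open>h\<close>, \<open>x\<close> and \<open>y\<close>: raising and
  lowering obey the same recursion with the two letters exchanged, and for \<open>i \<ge> 0\<close>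
  both \<open>head_inert\<close> and \<open>acts_at\<close> are symmetric in these letters.\<close>

lemma isotropic_operator_iff:
  assumes "0 \<le> i"
    and "h [] = None"
    and "\<And>b w. h (b # w) = (if head_inert i b w then map_option ((#) b) (h w)
       else if b = x then Some (y # w) else None)"
    and "{x, y} = {root_source i, root_target i}"
  shows "h w = Some w' \<longleftrightarrow> (\<exists>u v. w = u @ x # v \<and> w' = u @ y # v \<and> acts_at i u v)"
proof (induction w arbitrary: w')
  case Nil
  then show ?case using assms(2) by simp
next
  case (Cons b w)
  have Nil: "acts_at i [] w \<longleftrightarrow> \<not> head_inert i x w"
    using assms(1,4) by (auto simp: acts_at_def head_inert_def[OF i] doubleton_eq_iff)
  \<comment> \<open>For a half-integer \<open>i\<close> the second conjunct holds automatically, as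
    \<open>x\<close> occurs behind \<open>b\<close>; for an integer it says that \<open>b\<close> is
    neither letter.\<close>
  have Cons': "acts_at i (b # u) v \<longleftrightarrow> acts_at i u v \<and> head_inert i b (u @ x # v)" for u v
    using assms(1,4) by (auto simp: acts_at_def head_inert_def[OF i] doubleton_eq_iff)
  have "(\<exists>u v. b # w = u @ x # v \<and> w' = u @ y # v \<and> acts_at i u v) \<longleftrightarrow>
      (b = x \<and> w' = y # w \<and> acts_at i [] w) \<or>
      (\<exists>u v. w = u @ x # v \<and> w' = b # u @ y # v \<and> acts_at i (b # u) v)"
    (is "?L \<longleftrightarrow> ?R")
  proof
    assume ?L
    then show ?R by (auto simp: Cons_eq_append_conv)
  next
    assume ?R
    then consider "b = x" "w' = y # w" "acts_at i [] w"
      | u v where "w = u @ x # v" "w' = b # u @ y # v" "acts_at i (b # u) v" by blast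
    then show ?L
    proof cases
      case 1
      then show ?thesis by (intro exI[of _ "[]"] exI[of _ w]) simp
    next
      case (2 u v)
      then show ?thesis by (intro exI[of _ "b # u"] exI[of _ v]) simp
    qed
  qed
  also have "\<dots> \<longleftrightarrow> h (b # w) = Some w'"
    unfolding assms(3) using Cons.IH by (auto simp: Nil Cons')
  finally show ?case by blast
qed

theorem word_f_iff:
  "cf (word_crystal m) i w = Some w' \<longleftrightarrow>
    (\<exists>u v. w = u @ root_source i # v \<and> w' = u @ root_target i # v \<and> acts_at i u v)"
proof (cases "i < 0")
  case False
  then have "0 \<le> i" by simp
  then show ?thesis
    by (intro isotropic_operator_iff) (auto simp: isotropic_Cons[OF i])
qed (rule f_neg_iff)

theorem word_e_iff:
  "ce (word_crystal m) i w = Some w' \<longleftrightarrow>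
    (\<exists>u v. w = u @ root_target i # v \<and> w' = u @ root_source i # v \<and> acts_at i u v)"
proof (cases "i < 0")
  case False
  then have "0 \<le> i" by simp
  then show ?thesis
    by (intro isotropic_operator_iff) (auto simp: isotropic_Cons[OF i])
qed (rule e_neg_iff)

lemma isotropic_acts_at:
  assumes "0 \<le> i" "acts_at i u v"
  shows "ceps (word_crystal m) i (u @ root_source i # v) = 0"
    "ceps (word_crystal m) i (u @ root_target i # v) = 1"
    "cphi (word_crystal m) i (u @ root_source i # v) = 1"
    "cphi (word_crystal m) i (u @ root_target i # v) = 0"
  using assms(2) root_source_neq_target[of i] assms(1)
  by (induction u) (auto simp: isotropic_Cons[OF i assms(1)] head_inert_def[OF i] acts_at_def split: if_splits)

text \<open>For \<open>i < 0\<close> the change of \<open>cphi\<close> is deduced from that of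
  \<open>ceps\<close>: the latter rises by 1 while the pairing with the weight drops by 2.\<close>

lemma word_eps_phi_acts_at:
  assumes "acts_at i u v"
  shows "ceps (word_crystal m) i (u @ root_target i # v) =
      Suc (ceps (word_crystal m) i (u @ root_source i # v))"
    and "cphi (word_crystal m) i (u @ root_source i # v) =
      Suc (cphi (word_crystal m) i (u @ root_target i # v))"
proof -
  have "ceps (word_crystal m) i (u @ root_target i # v) =
      Suc (ceps (word_crystal m) i (u @ root_source i # v)) \<and>
      cphi (word_crystal m) i (u @ root_source i # v) =
      Suc (cphi (word_crystal m) i (u @ root_target i # v))"
  proof (cases "i < 0")
    case True
    then show ?thesis
      using eps_acts_at[OF True assms, of "root_target i"] eps_acts_at[OF True assms, of "root_source i"]
        phi_minus_eps_neg[OF i True, of "u @ root_source i # v"]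
        phi_minus_eps_neg[OF i True, of "u @ root_target i # v"] root_source_neq_target[of i]
      by (simp add: pairing_neg_root[OF i] lookup_add lookup_cwt)
  next
    case False
    then show ?thesis using isotropic_acts_at[OF _ assms] by simp
  qed
  then show "ceps (word_crystal m) i (u @ root_target i # v) =
      Suc (ceps (word_crystal m) i (u @ root_source i # v))"
    and "cphi (word_crystal m) i (u @ root_source i # v) =
      Suc (cphi (word_crystal m) i (u @ root_target i # v))" by auto
qed

lemma cwt_acts_at:
  "cwt (word_crystal m) (u @ root_target i # v) =
    cwt (word_crystal m) (u @ root_source i # v) - simple_root i"
  by (simp add: simple_root_def algebra_simps)

text \<open>In the absence of \<open>root_source i\<close>, the first or the last occurrence of
  \<open>root_target i\<close>, according to the tensor rule, satisfies
  \<open>acts_at\<close>.\<close>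

lemma isotropic_e_neq_None:
  assumes "0 \<le> i" "root_target i \<in> set w" "root_source i \<notin> set w"
  shows "ce (word_crystal m) i w \<noteq> None"
proof (cases "i \<in> \<int>")
  case True
  obtain u v where "w = u @ root_target i # v" "root_target i \<notin> set u"
    using split_list_first[OF assms(2)] by blast
  then have "ce (word_crystal m) i w = Some (u @ root_source i # v)"
    using assms True unfolding word_e_iff by (auto simp: acts_at_def)
  then show ?thesis by simp
next
  case False
  obtain u v where "w = u @ root_target i # v" "root_target i \<notin> set v"
    using split_list_last[OF assms(2)] by blast
  then have "ce (word_crystal m) i w = Some (u @ root_source i # v)"
    using assms False unfolding word_e_iff by (auto simp: acts_at_def)
  then show ?thesis by simp
qed

end

section \<open>The reading order and the shape of a ribbon\<close>

text \<open>The reading order as a relation on all pairs, so that prefixes and suffixes of the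
  reading word become sets of nodes described by coordinates.\<close>

definition before :: "nat \<times> nat \<Rightarrow> nat \<times> nat \<Rightarrow> bool" where
  "before x y \<longleftrightarrow> fst x < fst y \<or> fst x = fst y \<and> snd y < snd x"

lemma before_Pair [simp]: "before (r, c) (r', c') \<longleftrightarrow> r < r' \<or> r = r' \<and> c' < c"
  by (simp add: before_def)

lemma before_irrefl [simp]: "\<not> before x x"
  by (simp add: before_def)

lemma before_asym: "before x y \<Longrightarrow> \<not> before y x"
  by (auto simp: before_def)

lemma before_linear: "x \<noteq> y \<Longrightarrow> before x y \<or> before y x"
  by (auto simp: before_def prod_eq_iff)

text \<open>Offset, starting columns and row lengths are parameters, so that the body and the ribbon
  are both instances.\<close>

lemma sorted_wrt_before_rows:
  "sorted_wrt before (concat (map (\<lambda>k. map (\<lambda>j. (a + k, g k + j)) (rev [0..<n k])) [0..<l]))"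
proof (induction l)
  case (Suc l)
  have "sorted_wrt before (map (\<lambda>j. (a + l, g l + j)) (rev [0..<n l]))"
    by (simp add: sorted_wrt_map sorted_wrt_rev)
  then show ?case using Suc by (auto simp: sorted_wrt_append)
qed simp

lemma sorted_reading_order: "sorted_wrt before (reading_order lam \<alpha>)"
  using sorted_wrt_before_rows[of 0 "\<lambda>_. 0" "\<lambda>r. lam ! r" "length lam"]
    sorted_wrt_before_rows[of "length lam" "tail_col \<alpha>" "\<lambda>k. \<alpha> ! k" "length \<alpha>"]
  by (auto simp: reading_order_def sorted_wrt_append)

lemma set_reading_order: "set (reading_order lam \<alpha>) = diagram lam \<alpha>"
  by (auto simp: reading_order_def diagram_def body_def ribbon_def)

lemma finite_diagram: "finite (diagram lam \<alpha>)"
  by (metis List.finite_set set_reading_order)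

lemma distinct_sorted_before: "sorted_wrt before xs \<Longrightarrow> distinct xs"
  by (induction xs) auto

lemma sorted_before_split:
  assumes "sorted_wrt before (us @ x # vs)"
  shows "set us = {y \<in> set (us @ x # vs). before y x}"
    and "set vs = {y \<in> set (us @ x # vs). before x y}"
proof -
  have *: "before y x" if "y \<in> set us" for y using assms that by (auto simp: sorted_wrt_append)
  have **: "before x y" if "y \<in> set vs" for y using assms that by (auto simp: sorted_wrt_append)
  show "set us = {y \<in> set (us @ x # vs). before y x}"
    using * ** before_asym by fastforce
  show "set vs = {y \<in> set (us @ x # vs). before x y}"
    using * ** before_asym by fastforce
qed

lemma count_list_map_distinct:
  "distinct xs \<Longrightarrow> count_list (map f xs) b = card {x \<in> set xs. f x = b}"
proof (induction xs)
  case (Cons a xs)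
  have "{x \<in> set (a # xs). f x = b} =
      (if f a = b then insert a {x \<in> set xs. f x = b} else {x \<in> set xs. f x = b})" by auto
  then show ?case using Cons by simp
qed simp

lemma filling_of_reading_word:
  assumes "T \<in> extensional (diagram lam \<alpha>)"
  shows "filling_of_word lam \<alpha> (reading_word lam \<alpha> T) = T"
  unfolding filling_of_word_def
proof (rule the_equality)
  fix S assume S: "S \<in> extensional (diagram lam \<alpha>) \<and> reading_word lam \<alpha> S = reading_word lam \<alpha> T"
  show "S = T"
  proof (rule extensionalityI)
    show "S \<in> extensional (diagram lam \<alpha>)" using S by simp
    show "T \<in> extensional (diagram lam \<alpha>)" by fact
    show "S x = T x" if "x \<in> diagram lam \<alpha>" for x
      using S that unfolding reading_word_def set_reading_order[symmetric] by (simp add: map_eq_conv)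
  qed
qed (use assms in simp)

text \<open>Refers only to entries at nodes other than \<open>x\<close>, so it holds before an
  operator changes \<open>T x\<close> iff it holds afterwards.\<close>

definition acts_on :: "nat list \<Rightarrow> nat list \<Rightarrow> rat \<Rightarrow> filling \<Rightarrow> nat \<times> nat \<Rightarrow> bool" where
  "acts_on lam \<alpha> i T x \<longleftrightarrow>
    (\<exists>us vs. reading_order lam \<alpha> = us @ x # vs \<and> acts_at i (map T us) (map T vs))"

lemma acts_on_in_diagram: "acts_on lam \<alpha> i T x \<Longrightarrow> x \<in> diagram lam \<alpha>"
  unfolding acts_on_def set_reading_order[symmetric] by auto

lemma acts_on_nonneg_iff:
  assumes "0 \<le> i" "x \<in> diagram lam \<alpha>"
  shows "acts_on lam \<alpha> i T x \<longleftrightarrow>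
    (\<forall>y\<in>diagram lam \<alpha>. (if i \<in> \<int> then before y x else before x y) \<longrightarrow>
      T y \<noteq> root_source i \<and> T y \<noteq> root_target i)"
proof -
  have "acts_at i (map T us) (map T vs) \<longleftrightarrow>
    (\<forall>y\<in>diagram lam \<alpha>. (if i \<in> \<int> then before y x else before x y) \<longrightarrow>
      T y \<noteq> root_source i \<and> T y \<noteq> root_target i)"
    if "reading_order lam \<alpha> = us @ x # vs" for us vs
  proof -
    have "set us = {y \<in> diagram lam \<alpha>. before y x}" "set vs = {y \<in> diagram lam \<alpha>. before x y}"
      using sorted_before_split[OF sorted_reading_order[of lam \<alpha>, unfolded that]]
      unfolding set_reading_order[of lam \<alpha>, unfolded that] by simp_all
    then have "(b \<in> set (map T us) \<longleftrightarrow> (\<exists>y\<in>diagram lam \<alpha>. before y x \<and> T y = b)) \<and>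
        (b \<in> set (map T vs) \<longleftrightarrow> (\<exists>y\<in>diagram lam \<alpha>. before x y \<and> T y = b))" for b
      by auto
    then show ?thesis using assms(1) unfolding acts_at_def by (cases "i \<in> \<int>") auto
  qed
  moreover obtain us vs where "reading_order lam \<alpha> = us @ x # vs"
    using assms(2) unfolding set_reading_order[symmetric] by (meson split_list)
  ultimately show ?thesis unfolding acts_on_def by blast
qed

text \<open>The signature rule read off the diagram. The first inequality comes from the suffix,
  starting at \<open>z\<close>, of the word before \<open>x\<close>; the second from the prefix,
  ending at \<open>z\<close>, of the word after \<open>x\<close>. Both intervals exclude
  \<open>x\<close> and include \<open>z\<close>.\<close>

lemma
  assumes "i < 0" "acts_on lam \<alpha> i T x"
  shows acts_on_neg_before: "z \<in> diagram lam \<alpha> \<Longrightarrow> before z x \<Longrightarrow>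
      card {y \<in> diagram lam \<alpha>. (y = z \<or> before z y) \<and> before y x \<and> T y = root_source i} \<le>
      card {y \<in> diagram lam \<alpha>. (y = z \<or> before z y) \<and> before y x \<and> T y = root_target i}"
    and acts_on_neg_after: "z \<in> diagram lam \<alpha> \<Longrightarrow> before x z \<Longrightarrow>
      card {y \<in> diagram lam \<alpha>. before x y \<and> (y = z \<or> before y z) \<and> T y = root_target i} \<le>
      card {y \<in> diagram lam \<alpha>. before x y \<and> (y = z \<or> before y z) \<and> T y = root_source i}"
proof -
  obtain us vs where usvs: "reading_order lam \<alpha> = us @ x # vs" and acts: "acts_at i (map T us) (map T vs)"
    using assms(2) unfolding acts_on_def by blast
  note sorted = sorted_reading_order[of lam \<alpha>, unfolded usvs]
  note D = set_reading_order[of lam \<alpha>, unfolded usvs, symmetric]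
  {
    assume z: "z \<in> diagram lam \<alpha>" "before z x"
    moreover have "set us = {y \<in> diagram lam \<alpha>. before y x}"
      unfolding D by (rule sorted_before_split(1)[OF sorted])
    ultimately have "z \<in> set us" using z by simp
    then obtain p q where pq: "us = p @ z # q" by (meson split_list)
    \<comment> \<open>Cutting the reading order at \<open>z\<close> describes all that follows
      \<open>z\<close>; cutting this remainder at \<open>x\<close> leaves the nodes strictly between
      them.\<close>
    have "sorted_wrt before (p @ z # (q @ x # vs))" using sorted pq by simp
    from sorted_before_split(2)[OF this]
    have *: "set (q @ x # vs) = {y \<in> diagram lam \<alpha>. before z y}" unfolding D pq by (simp only: append_assoc append_Cons)
    have "sorted_wrt before (q @ x # vs)" using sorted pq by (simp add: sorted_wrt_append)
    then have "set q = {y \<in> set (q @ x # vs). before y x}" by (rule sorted_before_split(1))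
    also have "\<dots> = {y \<in> diagram lam \<alpha>. before z y \<and> before y x}" unfolding * by auto
    finally have q: "set q = {y \<in> diagram lam \<alpha>. before z y \<and> before y x}" .
    have "distinct (z # q)" using distinct_sorted_before[OF sorted] pq by auto
    moreover have "count_list (map T (z # q)) (root_source i) \<le> count_list (map T (z # q)) (root_target i)"
    proof -
      have "\<forall>p q. map T us = p @ q \<longrightarrow> count_list q (root_source i) \<le> count_list q (root_target i)"
        using acts assms(1) by (simp add: acts_at_def)
      moreover have "map T us = map T p @ map T (z # q)" using pq by simp
      ultimately show ?thesis by blast
    qed
    ultimately have "card {y \<in> set (z # q). T y = root_source i} \<le> card {y \<in> set (z # q). T y = root_target i}"
      by (simp only: count_list_map_distinct)
    moreover have "{y \<in> set (z # q). T y = b} =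
        {y \<in> diagram lam \<alpha>. (y = z \<or> before z y) \<and> before y x \<and> T y = b}" for b
      using q z by auto
    ultimately show "card {y \<in> diagram lam \<alpha>. (y = z \<or> before z y) \<and> before y x \<and> T y = root_source i} \<le>
      card {y \<in> diagram lam \<alpha>. (y = z \<or> before z y) \<and> before y x \<and> T y = root_target i}"
      by simp
  next
    assume z: "z \<in> diagram lam \<alpha>" "before x z"
    moreover have "set vs = {y \<in> diagram lam \<alpha>. before x y}"
      unfolding D by (rule sorted_before_split(2)[OF sorted])
    ultimately have "z \<in> set vs" using z by simp
    then obtain p q where pq: "vs = p @ z # q" by (meson split_list)
    have "sorted_wrt before ((us @ x # p) @ z # q)" using sorted pq by simp
    from sorted_before_split(1)[OF this]
    have *: "set (us @ x # p) = {y \<in> diagram lam \<alpha>. before y z}" unfolding D pq by (simp only: append_assoc append_Cons)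
    have "sorted_wrt before (us @ x # p)" using sorted pq by (simp add: sorted_wrt_append)
    then have "set p = {y \<in> set (us @ x # p). before x y}" by (rule sorted_before_split(2))
    also have "\<dots> = {y \<in> diagram lam \<alpha>. before y z \<and> before x y}" unfolding * by auto
    finally have p: "set p = {y \<in> diagram lam \<alpha>. before y z \<and> before x y}" .
    have "distinct (p @ [z])" using distinct_sorted_before[OF sorted] pq by auto
    moreover have "count_list (map T (p @ [z])) (root_target i) \<le> count_list (map T (p @ [z])) (root_source i)"
    proof -
      have "\<forall>p q. map T vs = p @ q \<longrightarrow> count_list p (root_target i) \<le> count_list p (root_source i)"
        using acts assms(1) by (simp add: acts_at_def)
      moreover have "map T vs = map T (p @ [z]) @ map T q" using pq by simp
      ultimately show ?thesis by blast
    qed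
    ultimately have "card {y \<in> set (p @ [z]). T y = root_target i} \<le> card {y \<in> set (p @ [z]). T y = root_source i}"
      by (simp only: count_list_map_distinct)
    moreover have "{y \<in> set (p @ [z]). T y = b} =
        {y \<in> diagram lam \<alpha>. before x y \<and> (y = z \<or> before y z) \<and> T y = b}" for b
      using p z by auto
    ultimately show "card {y \<in> diagram lam \<alpha>. before x y \<and> (y = z \<or> before y z) \<and> T y = root_target i} \<le>
      card {y \<in> diagram lam \<alpha>. before x y \<and> (y = z \<or> before y z) \<and> T y = root_source i}"
      by simp
  }
qed

lemma reading_word_split:
  assumes "reading_order lam \<alpha> = us @ x # vs"
  shows "reading_word lam \<alpha> T = map T us @ T x # map T vs"
    and "reading_word lam \<alpha> (T(x := b)) = map T us @ b # map T vs"
proof -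
  have "distinct (us @ x # vs)"
    using distinct_sorted_before[OF sorted_reading_order[of lam \<alpha>]] assms by simp
  then have "x \<notin> set us" "x \<notin> set vs" by auto
  then show "reading_word lam \<alpha> T = map T us @ T x # map T vs"
    and "reading_word lam \<alpha> (T(x := b)) = map T us @ b # map T vs"
    by (auto simp: reading_word_def assms)
qed

text \<open>One statement for raising and lowering. \<open>filling_of_word\<close> inverts the
  reading of any extensional filling, so this says where the operators act, while membership of
  \<open>T'\<close> in \<open>tableaux\<close> is a separate matter.\<close>

lemma word_operator_filling_iff:
  assumes "T \<in> extensional (diagram lam \<alpha>)"
    and "\<And>w w'. h w = Some w' \<longleftrightarrow> (\<exists>u v. w = u @ a # v \<and> w' = u @ b # v \<and> acts_at i u v)"
  shows "map_option (filling_of_word lam \<alpha>) (h (reading_word lam \<alpha> T)) = Some T' \<longleftrightarrow>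
    (\<exists>x. acts_on lam \<alpha> i T x \<and> T x = a \<and> T' = T(x := b))"
proof
  assume "map_option (filling_of_word lam \<alpha>) (h (reading_word lam \<alpha> T)) = Some T'"
  then obtain w' where w': "h (reading_word lam \<alpha> T) = Some w'" "T' = filling_of_word lam \<alpha> w'"
    by auto
  then obtain u v where uv: "reading_word lam \<alpha> T = u @ a # v" "w' = u @ b # v" "acts_at i u v"
    using assms(2) by blast
  then obtain us x vs where split: "reading_order lam \<alpha> = us @ x # vs" "u = map T us" "T x = a" "v = map T vs"
    by (auto simp: reading_word_def map_eq_append_conv map_eq_Cons_conv append_eq_map_conv Cons_eq_map_conv)
  have "T(x := b) \<in> extensional (diagram lam \<alpha>)"
    using assms(1) set_reading_order[of lam \<alpha>] split(1) by (auto simp: extensional_def)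
  then have "T' = T(x := b)"
    using filling_of_reading_word reading_word_split(2)[OF split(1), of T b] w' uv split by metis
  then show "\<exists>x. acts_on lam \<alpha> i T x \<and> T x = a \<and> T' = T(x := b)"
    using uv split unfolding acts_on_def by blast
next
  assume "\<exists>x. acts_on lam \<alpha> i T x \<and> T x = a \<and> T' = T(x := b)"
  then obtain x us vs where x: "reading_order lam \<alpha> = us @ x # vs" "acts_at i (map T us) (map T vs)"
    "T x = a" "T' = T(x := b)" unfolding acts_on_def by blast
  have "T(x := b) \<in> extensional (diagram lam \<alpha>)"
    using assms(1) set_reading_order[of lam \<alpha>] x(1) by (auto simp: extensional_def)
  then have "filling_of_word lam \<alpha> (map T us @ b # map T vs) = T'"
    using filling_of_reading_word reading_word_split(2)[OF x(1), of T b] x by metis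
  moreover have "h (reading_word lam \<alpha> T) = Some (map T us @ b # map T vs)"
    using assms(2) x reading_word_split(1)[OF x(1), of T] by auto
  ultimately show "map_option (filling_of_word lam \<alpha>) (h (reading_word lam \<alpha> T)) = Some T'" by simp
qed

section \<open>The diagram and the entries of a tableau\<close>

lemma ribbon_iff:
  "(r, c) \<in> ribbon lam \<alpha> \<longleftrightarrow> length lam \<le> r \<and> r - length lam < length \<alpha> \<and>
    tail_col \<alpha> (r - length lam) \<le> c \<and> c < tail_col \<alpha> (r - length lam) + \<alpha> ! (r - length lam)"
  by (auto simp: ribbon_def nat_le_iff_add)

lemma body_iff: "(r, c) \<in> body lam \<longleftrightarrow> r < length lam \<and> c < lam ! r"
  by (simp add: body_def)

text \<open>
  A ribbon is traversed to the right and downwards, so a filling of a ribbon is semistandard iff it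
  is weakly increasing along the ribbon, strictly at odd entries followed to the right and at even
  entries followed below.
\<close>

lemma ribbon_mono:
  fixes F :: "nat \<Rightarrow> nat \<Rightarrow> rat"
  assumes row: "\<And>k j j'. k < length \<alpha> \<Longrightarrow> j < j' \<Longrightarrow> j' < \<alpha> ! k \<Longrightarrow> F k j \<le> F k j'"
    and step: "\<And>k. Suc k < length \<alpha> \<Longrightarrow> F k (\<alpha> ! k - 1) \<le> F (Suc k) 0 \<and>
      (F k (\<alpha> ! k - 1) \<in> \<int> \<longrightarrow> F k (\<alpha> ! k - 1) \<noteq> F (Suc k) 0)"
    and pos: "\<And>k. k < length \<alpha> \<Longrightarrow> 0 < \<alpha> ! k"
  shows "k < k' \<Longrightarrow> k' < length \<alpha> \<Longrightarrow> j < \<alpha> ! k \<Longrightarrow> j' < \<alpha> ! k' \<Longrightarrow>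
    F k j \<le> F k' j' \<and> (F k j \<in> \<int> \<longrightarrow> F k j \<noteq> F k' j')"
proof (induction k' arbitrary: j')
  case (Suc k')
  have row': "F l j1 \<le> F l j2" if "l < length \<alpha>" "j1 \<le> j2" "j2 < \<alpha> ! l" for l j1 j2
    using row[of l j1 j2] that by (cases "j1 = j2") auto
  have last: "F k j \<le> F k' (\<alpha> ! k' - 1)"
    and last': "k \<noteq> k' \<Longrightarrow> F k j \<in> \<int> \<Longrightarrow> F k j \<noteq> F k' (\<alpha> ! k' - 1)"
    using Suc.IH[of "\<alpha> ! k' - 1"] Suc.prems row'[of k j "\<alpha> ! k - 1"] pos[of k']
    by (cases "k = k'"; force)+
  have first: "F (Suc k') 0 \<le> F (Suc k') j'" using row' Suc.prems by simp
  have "F k j \<le> F (Suc k') j'" using last first step[of k'] Suc.prems by force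
  moreover have "F k j < F (Suc k') j'" if "F k j \<in> \<int>"
  proof (cases "F k j = F k' (\<alpha> ! k' - 1)")
    case True
    then have "F k' (\<alpha> ! k' - 1) < F (Suc k') 0" using step[of k'] that Suc.prems by auto
    then show ?thesis using True first by simp
  next
    case False
    then show ?thesis using last first step[of k'] Suc.prems by force
  qed
  ultimately show ?case by auto
qed simp

lemma semistandard_upd:
  assumes "semistandard D T" "(r, c) \<in> D"
    and "\<And>c'. (r, c') \<in> D \<Longrightarrow> c < c' \<Longrightarrow> b \<le> T (r, c') \<and> (b \<notin> \<int> \<longrightarrow> b \<noteq> T (r, c'))"
    and "\<And>c'. (r, c') \<in> D \<Longrightarrow> c' < c \<Longrightarrow> T (r, c') \<le> b \<and> (T (r, c') \<notin> \<int> \<longrightarrow> T (r, c') \<noteq> b)"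
    and "\<And>r'. (r', c) \<in> D \<Longrightarrow> r < r' \<Longrightarrow> b \<le> T (r', c) \<and> (b \<in> \<int> \<longrightarrow> b \<noteq> T (r', c))"
    and "\<And>r'. (r', c) \<in> D \<Longrightarrow> r' < r \<Longrightarrow> T (r', c) \<le> b \<and> (T (r', c) \<in> \<int> \<longrightarrow> T (r', c) \<noteq> b)"
  shows "semistandard D (T((r, c) := b))"
  using assms unfolding semistandard_def by auto

text \<open>The alphabet has steps of 1 below 0 and of 1/2 above, and as 0 is missing, -1 and 1/2
  are neighbours.\<close>

lemma consecutive_letters:
  assumes "y \<in> letters m" "i \<in> indices m"
  shows "y \<le> root_source i \<or> root_target i \<le> y"
proof (rule ccontr)
  assume *: "\<not> ?thesis"
  have s: "2 * root_source i \<in> \<int>" "2 * root_target i \<in> \<int>" "2 * y \<in> \<int>"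
    using letters_double_Ints root_source_mem root_target_mem assms by blast+
  have 1: "root_source i + 1/2 \<le> y" "y + 1/2 \<le> root_target i"
    using * double_Ints_less_iff[OF s(1,3)] double_Ints_less_iff[OF s(3,2)] by auto
  \<comment> \<open>A letter in between keeps distance 1/2 from both ends, for which a root with
    \<open>i > 0\<close> has no room.\<close>
  then have neg: "i \<le> 0" by (auto simp: root_source_def root_target_def split: if_splits)
  then have "y \<le> 0" using 1 by (auto simp: root_source_def root_target_def split: if_splits)
  then have y: "y \<in> \<int>" "y \<le> -1" using letters_neg assms(1) by auto
  show False
  proof (cases "i = 0")
    case True
    then show ?thesis using y 1 by (auto simp: root_source_def)
  next
    case False
    then have "i < 0" using neg by simp
    then have "root_source i \<in> \<int>" "root_target i = root_source i + 1"
      using root_parity(1)[OF assms(2)] by (auto simp: root_source_def root_target_def)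
    then show ?thesis using 1 Ints_less_iff[of "root_source i" y] y by auto
  qed
qed

locale tail_shape =
  fixes m :: nat and lam \<alpha> :: "nat list"
  assumes shape: "(lam, \<alpha>) \<in> shapes m"
begin

abbreviation "\<D> \<equiv> diagram lam \<alpha>"

lemma length_lam: "length lam = m"
  using shape by (simp add: shapes_def)

lemma tail_pos: "k < length \<alpha> \<Longrightarrow> 0 < \<alpha> ! k"
  using shape by (auto simp: shapes_def)

lemma lam_antimono: "r \<le> r' \<Longrightarrow> r' < m \<Longrightarrow> lam ! r' \<le> lam ! r"
  using shape by (cases "r = r'") (auto simp: shapes_def sorted_wrt_iff_nth_less)

lemma body_subset: "body lam \<subseteq> \<D>" and ribbon_subset: "ribbon lam \<alpha> \<subseteq> \<D>"
  by (auto simp: diagram_def)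

lemma diagram_cases: "x \<in> \<D> \<Longrightarrow> x \<in> body lam \<or> x \<in> ribbon lam \<alpha>"
  by (simp add: diagram_def)

lemma body_closed: "(r, c) \<in> body lam \<Longrightarrow> r' \<le> r \<Longrightarrow> c' \<le> c \<Longrightarrow> (r', c') \<in> body lam"
  using lam_antimono[of r' r] by (auto simp: body_iff length_lam)

lemma ribbonI: "k < length \<alpha> \<Longrightarrow> j < \<alpha> ! k \<Longrightarrow> (m + k, tail_col \<alpha> k + j) \<in> ribbon lam \<alpha>"
  by (auto simp: ribbon_iff length_lam)

lemma ribbonE:
  assumes "x \<in> ribbon lam \<alpha>"
  obtains k j where "k < length \<alpha>" "j < \<alpha> ! k" "x = (m + k, tail_col \<alpha> k + j)"
  using assms by (auto simp: ribbon_def length_lam)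

lemma joint_mem: "\<alpha> \<noteq> [] \<Longrightarrow> (m, 0) \<in> ribbon lam \<alpha>"
  using ribbonI[of 0 0] tail_pos[of 0] by (simp add: tail_col_def)

lemma column_0_body: "\<alpha> \<noteq> [] \<Longrightarrow> r < m \<Longrightarrow> (r, 0) \<in> body lam"
proof -
  assume "\<alpha> \<noteq> []" "r < m"
  then have "0 < lam ! (m - 1)" "lam ! (m - 1) \<le> lam ! r"
    using lam_antimono[of r "m - 1"] shape by (auto simp: shapes_def)
  then have "0 < lam ! r" by simp
  then show ?thesis using \<open>r < m\<close> by (simp add: body_iff length_lam)
qed

context
  fixes T assumes T: "T \<in> tableaux m lam \<alpha>"
begin

lemma entry_mem: "x \<in> \<D> \<Longrightarrow> T x \<in> letters m"
  using T by (auto simp: tableaux_def)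

lemma extensional: "T \<in> extensional \<D>"
  using T by (auto simp: tableaux_def PiE_iff)

lemma semistandard: "semistandard \<D> T"
  using T by (simp add: tableaux_def)

lemma row_le: "(r, c) \<in> \<D> \<Longrightarrow> (r, c') \<in> \<D> \<Longrightarrow> c \<le> c' \<Longrightarrow> T (r, c) \<le> T (r, c')"
  using semistandard unfolding semistandard_def by (cases "c = c'") auto

lemma row_less: "(r, c) \<in> \<D> \<Longrightarrow> (r, c') \<in> \<D> \<Longrightarrow> c < c' \<Longrightarrow> T (r, c) \<notin> \<int> \<Longrightarrow> T (r, c) < T (r, c')"
  using semistandard unfolding semistandard_def by force

lemma col_le: "(r, c) \<in> \<D> \<Longrightarrow> (r', c) \<in> \<D> \<Longrightarrow> r \<le> r' \<Longrightarrow> T (r, c) \<le> T (r', c)"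
  using semistandard unfolding semistandard_def by (cases "r = r'") auto

lemma col_less: "(r, c) \<in> \<D> \<Longrightarrow> (r', c) \<in> \<D> \<Longrightarrow> r < r' \<Longrightarrow> T (r, c) \<in> \<int> \<Longrightarrow> T (r, c) < T (r', c)"
  using semistandard unfolding semistandard_def by force

lemma entry_ge: "r \<le> m \<Longrightarrow> (\<And>r'. r' \<le> r \<Longrightarrow> (r', c) \<in> \<D>) \<Longrightarrow> of_nat r - of_nat m \<le> T (r, c)"
proof (induction r)
  case 0
  then show ?case using letters_neg[OF entry_mem[of "(0, c)"]] by fastforce
next
  case (Suc r)
  have IH: "of_nat r - of_nat m \<le> T (r, c)" using Suc by simp
  have D: "(r, c) \<in> \<D>" "(Suc r, c) \<in> \<D>" using Suc.prems by auto
  have "of_nat (Suc r) \<le> (of_nat m :: rat)" using Suc.prems(1) of_nat_le_iff by blast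
  then have le0: "of_nat (Suc r) - of_nat m \<le> (0 :: rat)" by simp
  show ?case
  proof (cases "T (Suc r, c) \<le> 0")
    case True
    then have "T (r, c) \<le> 0" using col_le[OF D] by simp
    then have "T (r, c) \<in> \<int>" "T (Suc r, c) \<in> \<int>"
      using True letters_neg[OF entry_mem] D by auto
    then have "T (r, c) + 1 \<le> T (Suc r, c)" using col_less[OF D] Ints_less_iff by auto
    then show ?thesis using IH by simp
  qed (use le0 in linarith)
qed

text \<open>The \<open>m\<close> rows above the joint, whose column 0 is full, leave no negative
  letter for it.\<close>

lemma joint_pos:
  assumes "\<alpha> \<noteq> []"
  shows "0 < T (m, 0)"
proof -
  have D: "(m, 0) \<in> \<D>" using joint_mem[OF assms] ribbon_subset by auto
  have "(r, 0) \<in> \<D>" if "r \<le> m" for r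
    using D column_0_body[OF assms, of r] body_subset that by (cases "r = m") auto
  from entry_ge[of m 0, OF _ this] have "0 \<le> T (m, 0)" by simp
  then show ?thesis using letters_neg[OF entry_mem[OF D]] by force
qed

lemma tail_entry_mono:
  assumes "k < k'" "k' < length \<alpha>" "j < \<alpha> ! k" "j' < \<alpha> ! k'"
  shows "T (m + k, tail_col \<alpha> k + j) \<le> T (m + k', tail_col \<alpha> k' + j') \<and>
    (T (m + k, tail_col \<alpha> k + j) \<in> \<int> \<longrightarrow>
      T (m + k, tail_col \<alpha> k + j) \<noteq> T (m + k', tail_col \<alpha> k' + j'))"
proof (rule ribbon_mono[where F = "\<lambda>k j. T (m + k, tail_col \<alpha> k + j)", OF _ _ tail_pos assms])
  fix k j j' assume "k < length \<alpha>" "j < j'" "j' < \<alpha> ! k"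
  then show "T (m + k, tail_col \<alpha> k + j) \<le> T (m + k, tail_col \<alpha> k + j')"
    using row_le ribbonI ribbon_subset by (simp add: subset_iff)
next
  fix k assume k: "Suc k < length \<alpha>"
  have last: "(m + k, tail_col \<alpha> k + (\<alpha> ! k - 1)) \<in> \<D>"
    using ribbonI[of k "\<alpha> ! k - 1"] tail_pos[of k] k ribbon_subset by auto
  have "(m + Suc k, tail_col \<alpha> (Suc k) + 0) \<in> \<D>"
    using ribbonI[of "Suc k" 0] tail_pos[of "Suc k"] k ribbon_subset by auto
  \<comment> \<open>By \<open>tail_col\<close> a row starts in the column where the previous one
    ends, so the corner of the ribbon is a pair in one column.\<close>
  then have "(m + Suc k, tail_col \<alpha> k + (\<alpha> ! k - 1)) \<in> \<D>" by (simp add: tail_col_def)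
  from col_le[OF last this] col_less[OF last this]
  show "T (m + k, tail_col \<alpha> k + (\<alpha> ! k - 1)) \<le> T (m + Suc k, tail_col \<alpha> (Suc k) + 0) \<and>
    (T (m + k, tail_col \<alpha> k + (\<alpha> ! k - 1)) \<in> \<int> \<longrightarrow>
      T (m + k, tail_col \<alpha> k + (\<alpha> ! k - 1)) \<noteq> T (m + Suc k, tail_col \<alpha> (Suc k) + 0))"
    by (auto simp: tail_col_def)
qed

lemma joint_le_tail:
  assumes "x \<in> ribbon lam \<alpha>"
  shows "T (m, 0) \<le> T x"
proof -
  obtain k j where kj: "k < length \<alpha>" "j < \<alpha> ! k" "x = (m + k, tail_col \<alpha> k + j)"
    using assms by (rule ribbonE)
  show ?thesis
  proof (cases k)
    case 0
    then show ?thesis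
      using row_le[of m 0 j] kj ribbonI[of 0] tail_pos[of 0] ribbon_subset
      by (simp add: tail_col_def subset_iff)
  next
    case (Suc k')
    have "0 < length \<alpha>" using kj by linarith
    then show ?thesis
      using tail_entry_mono[of 0 k 0 j] kj tail_pos[of 0] Suc by (simp add: tail_col_def)
  qed
qed

lemma tail_entry_pos: "x \<in> ribbon lam \<alpha> \<Longrightarrow> 0 < T x"
  using joint_le_tail[of x] joint_pos by (force simp: ribbon_def)

lemma neg_in_body: "x \<in> \<D> \<Longrightarrow> T x \<le> 0 \<Longrightarrow> x \<in> body lam"
  using tail_entry_pos[of x] diagram_cases[of x] by auto

text \<open>The joint is positive, so the two cases in \<open>tableaux\<close> cover it. Their union
  is what the column conditions would say if the joint stood below every node of the body.\<close>

lemma body_le_joint: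
  assumes "\<alpha> \<noteq> []" "x \<in> body lam"
  shows "T x \<le> T (m, 0)" "T (m, 0) \<in> \<int> \<Longrightarrow> T x < T (m, 0)"
  using T assms joint_pos[OF assms(1)] by (auto simp: tableaux_def Let_def length_lam)

text \<open>The last two premises carry the condition on the joint: once with the changed node in
  the body, once with the joint itself changed.\<close>

lemma tableaux_upd:
  assumes "(r, c) \<in> \<D>" "b \<in> letters m"
    and "\<And>c'. (r, c') \<in> \<D> \<Longrightarrow> c < c' \<Longrightarrow> b \<le> T (r, c') \<and> (b \<notin> \<int> \<longrightarrow> b \<noteq> T (r, c'))"
    and "\<And>c'. (r, c') \<in> \<D> \<Longrightarrow> c' < c \<Longrightarrow> T (r, c') \<le> b \<and> (T (r, c') \<notin> \<int> \<longrightarrow> T (r, c') \<noteq> b)"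
    and "\<And>r'. (r', c) \<in> \<D> \<Longrightarrow> r < r' \<Longrightarrow> b \<le> T (r', c) \<and> (b \<in> \<int> \<longrightarrow> b \<noteq> T (r', c))"
    and "\<And>r'. (r', c) \<in> \<D> \<Longrightarrow> r' < r \<Longrightarrow> T (r', c) \<le> b \<and> (T (r', c) \<in> \<int> \<longrightarrow> T (r', c) \<noteq> b)"
    and "\<alpha> \<noteq> [] \<Longrightarrow> (r, c) \<in> body lam \<Longrightarrow> b \<le> T (m, 0) \<and> (T (m, 0) \<in> \<int> \<longrightarrow> b \<noteq> T (m, 0))"
    and "\<And>y. \<alpha> \<noteq> [] \<Longrightarrow> (r, c) = (m, 0) \<Longrightarrow> y \<in> body lam \<Longrightarrow> T y \<le> b \<and> (b \<in> \<int> \<longrightarrow> T y \<noteq> b)"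
  shows "T((r, c) := b) \<in> tableaux m lam \<alpha>"
proof -
  have "T((r, c) := b) \<in> \<D> \<rightarrow>\<^sub>E letters m"
    using assms(1,2) entry_mem extensional by (auto simp: PiE_iff extensional_def)
  moreover have "semistandard \<D> (T((r, c) := b))"
    by (rule semistandard_upd) (use semistandard assms(1,3-6) in auto)
  moreover have "(b' \<in> \<int> \<and> 0 < b' \<longrightarrow> (\<forall>x\<in>body lam. (T((r, c) := b)) x < b')) \<and>
      (b' \<notin> \<int> \<longrightarrow> (\<forall>x\<in>body lam. (T((r, c) := b)) x \<le> b'))"
    if "\<alpha> \<noteq> []" and b': "b' = (T((r, c) := b)) (m, 0)" for b'
  proof -
    have "(m, 0) \<notin> body lam" by (simp add: body_iff length_lam)
    show ?thesis
    proof (cases "(r, c) = (m, 0)")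
      case True
      then show ?thesis using \<open>(m, 0) \<notin> body lam\<close> assms(8) that by force
    next
      case False
      then have "b' = T (m, 0)" using b' by auto
      then show ?thesis using assms(7) body_le_joint that(1) by (auto simp: order.strict_iff_order)
    qed
  qed
  ultimately show ?thesis by (auto simp: tableaux_def Let_def length_lam)
qed

end

end

section \<open>Closure under the operators\<close>

context tail_shape
begin

context
  fixes T i x
  assumes T: "T \<in> tableaux m lam \<alpha>" and i: "i \<in> indices m" and acts: "acts_on lam \<alpha> i T x"
begin

lemma root_mem_diagram: "x \<in> \<D>"
  using acts by (rule acts_on_in_diagram)

lemma consecutive_entries: "y \<in> \<D> \<Longrightarrow> T y \<le> root_source i \<or> root_target i \<le> T y"
  using consecutive_letters[OF entry_mem[OF T] i] .

lemma entry_between: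
  "y \<in> \<D> \<Longrightarrow> root_source i < T y \<Longrightarrow> T y \<le> root_target i \<Longrightarrow> T y = root_target i"
  "y \<in> \<D> \<Longrightarrow> root_source i \<le> T y \<Longrightarrow> T y < root_target i \<Longrightarrow> T y = root_source i"
  using consecutive_entries[of y] by auto

lemma inert_entries:
  assumes "0 \<le> i" "y \<in> \<D>" "if i \<in> \<int> then before y x else before x y"
  shows "T y \<noteq> root_source i" "T y \<noteq> root_target i"
  using acts assms acts_on_nonneg_iff[OF assms(1) root_mem_diagram] by auto

text \<open>From \<open>(r, c')\<close> to \<open>x\<close> the reading stays in row
  \<open>r\<close> and meets only entries at most \<open>T (r, c')\<close>. If that were
  \<open>root_source i\<close>, the interval would contain a source and no target to cancel
  it.\<close>

lemma neg_no_source_right: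
  assumes "i < 0" "x = (r, c)" "(r, c') \<in> \<D>" "c < c'"
  shows "T (r, c') \<noteq> root_source i"
proof
  assume eq: "T (r, c') = root_source i"
  let ?I = "\<lambda>b. {y \<in> \<D>. (y = (r, c') \<or> before (r, c') y) \<and> before y x \<and> T y = b}"
  have "?I (root_target i) = {}"
  proof -
    have "T y \<noteq> root_target i" if y: "y \<in> \<D>" "y = (r, c') \<or> before (r, c') y" "before y x" for y
    proof -
      obtain c'' where "y = (r, c'')" "c'' \<le> c'" using y assms(2) by (cases y) auto
      then have "T y \<le> T (r, c')" using row_le[OF T] y(1) assms(3) by auto
      then show ?thesis using eq root_source_less_target[of i] by simp
    qed
    then show ?thesis by auto
  qed
  moreover have "card (?I (root_source i)) \<le> card (?I (root_target i))"
    using acts_on_neg_before[OF assms(1) acts assms(3)] assms(2,4) by simp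
  moreover have "(r, c') \<in> ?I (root_source i)" using assms eq by simp
  moreover have "finite (?I (root_source i))" by (simp add: finite_diagram)
  ultimately show False by (metis (lifting) card.empty card_eq_0_iff empty_iff le_zero_eq)
qed

text \<open>Mirror image: from \<open>x\<close> on to \<open>(r, c')\<close> all entries would be at
  least \<open>root_target i\<close>, so the interval would contain a target and no source.\<close>

lemma neg_no_target_left:
  assumes "i < 0" "x = (r, c)" "(r, c') \<in> \<D>" "c' < c"
  shows "T (r, c') \<noteq> root_target i"
proof
  assume eq: "T (r, c') = root_target i"
  let ?I = "\<lambda>b. {y \<in> \<D>. before x y \<and> (y = (r, c') \<or> before y (r, c')) \<and> T y = b}"
  have "?I (root_source i) = {}"
  proof -
    have "T y \<noteq> root_source i" if y: "y \<in> \<D>" "y = (r, c') \<or> before y (r, c')" "before x y" for y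
    proof -
      obtain c'' where "y = (r, c'')" "c' \<le> c''" using y assms(2) by (cases y) auto
      then have "T (r, c') \<le> T y" using row_le[OF T] y(1) assms(3) by auto
      then show ?thesis using eq root_source_less_target[of i] by simp
    qed
    then show ?thesis by auto
  qed
  moreover have "card (?I (root_target i)) \<le> card (?I (root_source i))"
    using acts_on_neg_after[OF assms(1) acts assms(3)] assms(2,4) by simp
  moreover have "(r, c') \<in> ?I (root_target i)" using assms eq by simp
  moreover have "finite (?I (root_target i))" by (simp add: finite_diagram)
  ultimately show False by (metis (lifting) card.empty card_eq_0_iff empty_iff le_zero_eq)
qed

text \<open>
  If the entry below were \<open>root_target i\<close>, then so would be the entries below all entries
  \<open>root_source i\<close> to the left of \<open>x\<close>, and there would be too few of the latter to cancel the former.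
\<close>

lemma neg_no_target_below:
  assumes "i < 0" "x = (r, c)" "T x = root_source i" "(r', c) \<in> \<D>" "r < r'"
  shows "T (r', c) \<noteq> root_target i"
proof
  assume eq: "T (r', c) = root_target i"
  have xD: "(r, c) \<in> \<D>" using root_mem_diagram assms(2) by simp
  have Z: "root_source i \<in> \<int>" and neg: "root_target i < 0"
    using root_parity(1)[OF i assms(1)] assms(1) by (auto simp: root_target_def)
  have below_body: "(Suc r, c) \<in> body lam"
    using neg_in_body[OF T assms(4)] eq neg body_closed[of r' c "Suc r" c] assms(5) by simp
  have below: "T (Suc r, c') = root_target i"
    if "(r, c') \<in> \<D>" "c' \<le> c" "T (r, c') = root_source i" for c'
  proof (rule entry_between)
    have D: "(Suc r, c') \<in> \<D>" "(Suc r, c) \<in> \<D>"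
      using body_closed[OF below_body, of "Suc r" c'] that(2) below_body body_subset by auto
    show "(Suc r, c') \<in> \<D>" by fact
    show "root_source i < T (Suc r, c')" using col_less[OF T that(1) D(1)] that(3) Z by simp
    have "T (Suc r, c') \<le> T (Suc r, c)" using row_le[OF T D that(2)] .
    also have "\<dots> \<le> T (r', c)" using col_le[OF T D(2) assms(4)] assms(5) by simp
    finally show "T (Suc r, c') \<le> root_target i" using eq by simp
  qed
  define c0 where "c0 = (LEAST c'. (r, c') \<in> \<D> \<and> T (r, c') = root_source i)"
  have c0: "(r, c0) \<in> \<D>" "T (r, c0) = root_source i" "c0 \<le> c"
    using LeastI[of "\<lambda>c'. (r, c') \<in> \<D> \<and> T (r, c') = root_source i" c]
      Least_le[of "\<lambda>c'. (r, c') \<in> \<D> \<and> T (r, c') = root_source i" c] xD assms(2,3)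
    by (auto simp: c0_def)
  have c0_min: "c0 \<le> c'" if "(r, c') \<in> \<D>" "T (r, c') = root_source i" for c'
    unfolding c0_def using that by (intro Least_le) simp
  have run: "(r, c') \<in> \<D>" "T (r, c') = root_source i" if "c0 \<le> c'" "c' \<le> c" for c'
  proof -
    have "(r, c') \<in> body lam" using body_closed[OF below_body, of r c'] that by simp
    then show D: "(r, c') \<in> \<D>" using body_subset by auto
    show "T (r, c') = root_source i"
      using row_le[OF T c0(1) D that(1)] row_le[OF T D xD that(2)] c0(2) assms(2,3) by simp
  qed
  \<comment> \<open>The node below the start of the run of \<open>root_source i\<close> that ends at
    \<open>x\<close>. The interval from \<open>x\<close> to \<open>?z\<close> omits \<open>x\<close>
    from the run but contains the targets below the whole run, hence one target too many.\<close>
  let ?z = "(Suc r, c0)"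
  let ?I = "\<lambda>b. {y \<in> \<D>. before x y \<and> (y = ?z \<or> before y ?z) \<and> T y = b}"
  have zD: "?z \<in> \<D>" using body_closed[OF below_body, of "Suc r" c0] c0(3) body_subset by auto
  have fin: "finite (?I b)" for b by (simp add: finite_diagram)
  have "(\<lambda>c'. (Suc r, c')) ` {c0..c} \<subseteq> ?I (root_target i)"
  proof
    fix y assume "y \<in> (\<lambda>c'. (Suc r, c')) ` {c0..c}"
    then obtain c' where c': "y = (Suc r, c')" "c0 \<le> c'" "c' \<le> c" by auto
    moreover have "y \<in> \<D>" using body_closed[OF below_body, of "Suc r" c'] c' body_subset by auto
    ultimately show "y \<in> ?I (root_target i)" using below run assms(2) by auto
  qed
  then have "card ((\<lambda>c'. (Suc r, c')) ` {c0..c}) \<le> card (?I (root_target i))"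
    using card_mono fin by blast
  also have "\<dots> \<le> card (?I (root_source i))"
    using acts_on_neg_after[OF assms(1) acts zD] assms(2) by simp
  also have "\<dots> \<le> card ((\<lambda>c'. (r, c')) ` {c0..<c})"
  proof (rule card_mono)
    show "?I (root_source i) \<subseteq> (\<lambda>c'. (r, c')) ` {c0..<c}"
    proof
      fix y assume y: "y \<in> ?I (root_source i)"
      obtain r1 c1 where y1: "y = (r1, c1)" by (cases y)
      consider "r1 = r" "c1 < c" | "r1 = Suc r" "c0 \<le> c1"
        using y y1 assms(2) by fastforce
      then show "y \<in> (\<lambda>c'. (r, c')) ` {c0..<c}"
      proof cases
        case 1
        then show ?thesis using c0_min y y1 by auto
      next
        case 2
        then have "(Suc r, c1) \<in> \<D>" using y y1 by simp
        from row_le[OF T zD this 2(2)] have "T ?z \<le> T y" using y1 2(1) by simp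
        then show ?thesis
          using below[OF c0(1,3,2)] y root_source_less_target[of i] by simp
      qed
    qed
  qed simp
  finally show False using c0(3) by (simp add: card_image inj_on_def)
qed

text \<open>The preceding count, read towards \<open>x\<close>: a run of
  \<open>root_source i\<close> in row \<open>q\<close> begins above \<open>x\<close> and extends to
  the right, and each \<open>root_target i\<close> to the right of \<open>x\<close> has an entry of
  this run above it. Since \<open>x\<close> is outside the interval, there is one source too
  many.\<close>

lemma neg_no_source_above:
  assumes "i < 0" "x = (r, c)" "T x = root_target i" "(r', c) \<in> \<D>" "r' < r"
  shows "T (r', c) \<noteq> root_source i"
proof
  assume eq: "T (r', c) = root_source i"
  have xD: "(r, c) \<in> \<D>" using root_mem_diagram assms(2) by simp
  have Z: "root_target i \<in> \<int>" "root_source i \<in> \<int>" and neg: "root_target i < 0"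
    using root_parity(1,2)[OF i assms(1)] assms(1) by (auto simp: root_target_def)
  have x_body: "(r, c) \<in> body lam"
    using neg_in_body[OF T xD] assms(2,3) neg by simp
  obtain q where q: "r = Suc q" using assms(5) by (cases r) auto
  have above: "(q, c') \<in> \<D>" "T (q, c') < T (r, c')" if "(r, c') \<in> \<D>" "T (r, c') = root_target i" for c'
  proof -
    have "(r, c') \<in> body lam" using neg_in_body[OF T that(1)] that(2) neg by simp
    then show D: "(q, c') \<in> \<D>" using body_closed[of r c' q c'] body_subset q by auto
    have "T (q, c') \<le> T (r, c')" using col_le[OF T D that(1)] q by simp
    then have "T (q, c') \<in> \<int>" using letters_neg[OF entry_mem[OF T D]] that(2) neg by simp
    then show "T (q, c') < T (r, c')" using col_less[OF T D that(1)] q by simp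
  qed
  have qD: "(q, c) \<in> \<D>" and qc: "T (q, c) = root_source i"
  proof -
    show "(q, c) \<in> \<D>" using above xD assms(2,3) by simp
    then show "T (q, c) = root_source i"
      using entry_between(2)[of "(q, c)"] above[of c] xD assms(2,3,5)
        col_le[OF T assms(4), of q] eq q by auto
  qed
  define A where "A = {c'. (q, c') \<in> \<D> \<and> T (q, c') = root_source i}"
  have "finite A"
    by (rule finite_subset[of _ "snd ` \<D>"]) (force simp: A_def finite_diagram)+
  moreover have "c \<in> A" using qD qc by (simp add: A_def)
  ultimately have c1: "Max A \<in> A" "c \<le> Max A" "\<And>c'. c' \<in> A \<Longrightarrow> c' \<le> Max A"
    using Max_in by auto
  let ?z = "(q, Max A)"
  let ?I = "\<lambda>b. {y \<in> \<D>. (y = ?z \<or> before ?z y) \<and> before y x \<and> T y = b}"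
  have zD: "?z \<in> \<D>" "T ?z = root_source i" using c1(1) by (auto simp: A_def)
  have fin: "finite (?I b)" for b by (simp add: finite_diagram)
  have run: "(q, c') \<in> \<D>" "T (q, c') = root_source i" if "c \<le> c'" "c' \<le> Max A" for c'
  proof -
    have "?z \<in> body lam"
      using neg_in_body[OF T zD(1)] zD(2) neg root_source_less_target[of i] by simp
    then show D: "(q, c') \<in> \<D>" using body_closed[of q "Max A" q c'] body_subset that by auto
    show "T (q, c') = root_source i"
      using row_le[OF T qD D that(1)] row_le[OF T D zD(1) that(2)] qc zD(2) by simp
  qed
  have "(\<lambda>c'. (q, c')) ` {c..Max A} \<subseteq> ?I (root_source i)"
    using run assms(2) q by auto
  then have "card ((\<lambda>c'. (q, c')) ` {c..Max A}) \<le> card (?I (root_source i))"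
    using card_mono fin by blast
  also have "\<dots> \<le> card (?I (root_target i))"
    using acts_on_neg_before[OF assms(1) acts zD(1)] assms(2) q by simp
  also have "\<dots> \<le> card ((\<lambda>c'. (r, c')) ` {c<..Max A})"
  proof (rule card_mono)
    show "?I (root_target i) \<subseteq> (\<lambda>c'. (r, c')) ` {c<..Max A}"
    proof
      fix y assume y: "y \<in> ?I (root_target i)"
      obtain r1 c1 where y1: "y = (r1, c1)" by (cases y)
      consider "r1 = q" "c1 \<le> Max A" | "r1 = r" "c < c1"
        using y y1 assms(2) q by fastforce
      then show "y \<in> (\<lambda>c'. (r, c')) ` {c<..Max A}"
      proof cases
        case 1
        then have "(q, c1) \<in> \<D>" using y y1 by simp
        from row_le[OF T this zD(1) 1(2)] have "T y \<le> T ?z" using y1 1(1) by simp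
        then show ?thesis using y zD(2) root_source_less_target[of i] by simp
      next
        case 2
        then have *: "(q, c1) \<in> \<D>" "T (q, c1) < root_target i" using above[of c1] y y1 by auto
        moreover have "root_source i \<le> T (q, c1)"
          using row_le[OF T qD *(1)] qc 2 by simp
        ultimately have "c1 \<in> A" using entry_between(2) by (simp add: A_def)
        then show ?thesis using c1(3) 2 y1 by auto
      qed
    qed
  qed simp
  finally show False using c1(2) by (simp add: card_image inj_on_def)
qed

text \<open>The entry grows, so only the nodes to the right and below, and the joint in case of a
  body node, can object. Room is made by strictness at \<open>root_source i\<close>, by
  \<open>inert_entries\<close> for \<open>i \<ge> 0\<close>, and by the cancellation lemmas for
  \<open>i < 0\<close>.\<close>

lemma tableaux_f:
  assumes Tx: "T x = root_source i"
  shows "T(x := root_target i) \<in> tableaux m lam \<alpha>"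
proof -
  obtain r c where x: "x = (r, c)" by (cases x)
  have xD: "(r, c) \<in> \<D>" using root_mem_diagram x by simp
  have Tx': "T (r, c) = root_source i" using Tx x by simp
  note st = root_source_less_target[of i]
  have right: "root_target i \<le> T (r, c') \<and> (root_target i \<notin> \<int> \<longrightarrow> root_target i \<noteq> T (r, c'))"
    if c': "(r, c') \<in> \<D>" "c < c'" for c'
  proof (cases "0 \<le> i \<and> i \<notin> \<int>")
    case True
    then have "root_source i < T (r, c')"
      using row_less[OF T xD c'] Tx' root_parity(3)[OF i] by simp
    then show ?thesis
      using consecutive_entries[OF c'(1)] root_parity(4)[OF i] True by simp
  next
    case False
    then have "T (r, c') \<noteq> root_source i" "root_target i \<notin> \<int> \<longrightarrow> root_target i \<noteq> T (r, c')"
      using neg_no_source_right[OF _ x c'] inert_entries[OF _ c'(1)] root_parity(2)[OF i] x c'(2)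
      by (cases "i < 0"; auto)+
    moreover have "root_source i \<le> T (r, c')" using row_le[OF T xD c'(1)] Tx' c'(2) by simp
    ultimately show ?thesis using consecutive_entries[OF c'(1)] by auto
  qed
  have below: "root_target i \<le> T (r', c) \<and> (root_target i \<in> \<int> \<longrightarrow> root_target i \<noteq> T (r', c))"
    if r': "(r', c) \<in> \<D>" "r < r'" for r'
  proof (cases "0 \<le> i \<and> i \<notin> \<int>")
    case True
    then have "T (r', c) \<noteq> root_source i" "T (r', c) \<noteq> root_target i"
      using inert_entries[OF _ r'(1)] x r'(2) by auto
    moreover have "root_source i \<le> T (r', c)" using col_le[OF T xD r'(1)] Tx' r'(2) by simp
    ultimately show ?thesis using consecutive_entries[OF r'(1)] by auto
  next
    case False
    then have "root_source i \<in> \<int>" using root_parity(1,3)[OF i] by force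
    then have "root_source i < T (r', c)" using col_less[OF T xD r'] Tx' by simp
    moreover have "root_target i \<in> \<int> \<longrightarrow> root_target i \<noteq> T (r', c)"
      using neg_no_target_below[OF _ x Tx r'] root_parity(4)[OF i] False by force
    ultimately show ?thesis using consecutive_entries[OF r'(1)] by auto
  qed
  show ?thesis unfolding x
  proof (rule tableaux_upd[OF T xD root_target_mem[OF i] right _ below])
    show "T (r, c') \<le> root_target i \<and> (T (r, c') \<notin> \<int> \<longrightarrow> T (r, c') \<noteq> root_target i)"
      if "(r, c') \<in> \<D>" "c' < c" for c'
      using row_le[OF T that(1) xD] that(2) Tx' st by simp
    show "T (r', c) \<le> root_target i \<and> (T (r', c) \<in> \<int> \<longrightarrow> T (r', c) \<noteq> root_target i)"
      if "(r', c) \<in> \<D>" "r' < r" for r'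
      using col_le[OF T that(1) xD] that(2) Tx' st by simp
    show "root_target i \<le> T (m, 0) \<and> (T (m, 0) \<in> \<int> \<longrightarrow> root_target i \<noteq> T (m, 0))"
      if \<alpha>: "\<alpha> \<noteq> []" and xb: "(r, c) \<in> body lam"
    proof (cases "i < 0")
      case True
      then show ?thesis using joint_pos[OF T \<alpha>] by (simp add: root_target_def)
    next
      case False
      have joint: "(m, 0) \<in> \<D>" using joint_mem[OF \<alpha>] ribbon_subset by auto
      \<comment> \<open>The joint is read after the whole body, so for a half-integer
        \<open>i\<close> it is neither letter. For an integer \<open>i\<close>, parity and the
        strict case of the joint condition separate it from \<open>root_source i\<close>.\<close>
      have "before x (m, 0)" using xb x by (simp add: body_iff length_lam)
      then have "i \<notin> \<int> \<Longrightarrow> T (m, 0) \<noteq> root_source i \<and> T (m, 0) \<noteq> root_target i"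
        using inert_entries[OF _ joint] False by simp
      moreover have "root_source i \<le> T (m, 0)" "T (m, 0) \<in> \<int> \<Longrightarrow> root_source i < T (m, 0)"
        using body_le_joint[OF T \<alpha> xb] Tx' by auto
      ultimately show ?thesis
        using consecutive_entries[OF joint] root_parity(3,4)[OF i] False by force
    qed
    show "T y \<le> root_target i \<and> (root_target i \<in> \<int> \<longrightarrow> T y \<noteq> root_target i)"
      if "\<alpha> \<noteq> []" "(r, c) = (m, 0)" "y \<in> body lam" for y
      using body_le_joint(1)[OF T that(1,3)] that(2) Tx' st by auto
  qed
qed

text \<open>The entry shrinks, so the nodes to the left and above matter and, if \<open>x\<close> is
  the joint, the whole body. Strictness now excludes a second \<open>root_target i\<close>: in the
  row if this letter is odd, in the column if it is even.\<close>

lemma tableaux_e: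
  assumes Tx: "T x = root_target i"
  shows "T(x := root_source i) \<in> tableaux m lam \<alpha>"
proof -
  obtain r c where x: "x = (r, c)" by (cases x)
  have xD: "(r, c) \<in> \<D>" using root_mem_diagram x by simp
  have Tx': "T (r, c) = root_target i" using Tx x by simp
  note st = root_source_less_target[of i]
  have left: "T (r, c') \<le> root_source i \<and> (T (r, c') \<notin> \<int> \<longrightarrow> T (r, c') \<noteq> root_source i)"
    if c': "(r, c') \<in> \<D>" "c' < c" for c'
  proof -
    have "T (r, c') \<noteq> root_target i"
    proof (cases "0 \<le> i \<and> i \<in> \<int>")
      case True
      then show ?thesis using row_less[OF T c'(1) xD c'(2)] Tx' root_parity(4)[OF i] by force
    next
      case False
      then show ?thesis
        using neg_no_target_left[OF _ x c'] inert_entries(2)[OF _ c'(1)] x c'(2)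
        by (cases "i < 0") auto
    qed
    moreover have "T (r, c') \<notin> \<int> \<longrightarrow> T (r, c') \<noteq> root_source i"
      using root_parity(1,3)[OF i] inert_entries(1)[OF _ c'(1)] x c'(2) by force
    moreover have "T (r, c') \<le> root_target i" using row_le[OF T c'(1) xD] Tx' c'(2) by simp
    ultimately show ?thesis using consecutive_entries[OF c'(1)] by auto
  qed
  have above: "T (r', c) \<le> root_source i \<and> (T (r', c) \<in> \<int> \<longrightarrow> T (r', c) \<noteq> root_source i)"
    if r': "(r', c) \<in> \<D>" "r' < r" for r'
  proof -
    have le: "T (r', c) \<le> root_target i" using col_le[OF T r'(1) xD] Tx' r'(2) by simp
    have "T (r', c) \<noteq> root_target i"
    proof (cases "0 \<le> i \<and> i \<in> \<int>")
      case True
      then show ?thesis using inert_entries(2)[OF _ r'(1)] x r'(2) by simp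
    next
      case False
      then have "root_target i \<in> \<int>" using root_parity(2,4)[OF i] by force
      then show ?thesis using col_less[OF T r'(1) xD r'(2)] Tx' by force
    qed
    moreover have "T (r', c) \<in> \<int> \<longrightarrow> T (r', c) \<noteq> root_source i"
      using root_parity(3)[OF i] inert_entries(1)[OF _ r'(1)] x r'(2)
        neg_no_source_above[OF _ x Tx r'] by force
    ultimately show ?thesis using consecutive_entries[OF r'(1)] le by auto
  qed
  show ?thesis unfolding x
  proof (rule tableaux_upd[OF T xD root_source_mem[OF i] _ left _ above])
    show "root_source i \<le> T (r, c') \<and> (root_source i \<notin> \<int> \<longrightarrow> root_source i \<noteq> T (r, c'))"
      if "(r, c') \<in> \<D>" "c < c'" for c'
      using row_le[OF T xD that(1)] that(2) Tx' st by simp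
    show "root_source i \<le> T (r', c) \<and> (root_source i \<in> \<int> \<longrightarrow> root_source i \<noteq> T (r', c))"
      if "(r', c) \<in> \<D>" "r < r'" for r'
      using col_le[OF T xD that(1)] that(2) Tx' st by simp
    show "root_source i \<le> T (m, 0) \<and> (T (m, 0) \<in> \<int> \<longrightarrow> root_source i \<noteq> T (m, 0))"
      if "\<alpha> \<noteq> []" "(r, c) \<in> body lam"
      using body_le_joint(1)[OF T that] Tx' st by simp
    show "T y \<le> root_source i \<and> (root_source i \<in> \<int> \<longrightarrow> T y \<noteq> root_source i)"
      if \<alpha>: "\<alpha> \<noteq> []" and joint: "(r, c) = (m, 0)" and y: "y \<in> body lam" for y
    proof -
      \<comment> \<open>A positive letter is the target of a root only for \<open>i \<ge> 0\<close>,
        so the inert entries suffice.\<close>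
      have "0 < root_target i" using joint_pos[OF T \<alpha>] joint Tx' by auto
      then have i0: "0 \<le> i" by (auto simp: root_target_def split: if_splits)
      have yD: "y \<in> \<D>" using y body_subset by auto
      have "before y x" using y x joint by (cases y) (simp add: body_iff length_lam)
      then have "i \<in> \<int> \<Longrightarrow> T y \<noteq> root_source i \<and> T y \<noteq> root_target i"
        using inert_entries[OF i0 yD] by simp
      moreover have "T y \<le> root_target i" "root_target i \<in> \<int> \<Longrightarrow> T y < root_target i"
        using body_le_joint[OF T \<alpha> y] joint Tx' by auto
      ultimately show ?thesis
        using consecutive_entries[OF yD] root_parity(3,4)[OF i i0] by force
    qed
  qed
qed

end

end

section \<open>Sources\<close>

lemma first_cell:
  assumes "y \<in> diagram lam \<alpha>" "P y"
  shows "\<exists>us x vs. reading_order lam \<alpha> = us @ x # vs \<and> P x \<and> x \<in> diagram lam \<alpha> \<and>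
    (\<forall>z\<in>diagram lam \<alpha>. before z x \<longrightarrow> \<not> P z) \<and> set us = {z \<in> diagram lam \<alpha>. before z x}"
proof -
  have "\<exists>x\<in>set (reading_order lam \<alpha>). P x" using assms set_reading_order[of lam \<alpha>] by auto
  then obtain us x vs where split: "reading_order lam \<alpha> = us @ x # vs" "P x" "\<forall>y\<in>set us. \<not> P y"
    by (rule split_list_first_propE)
  note D = set_reading_order[of lam \<alpha>, unfolded split(1), symmetric]
  have us: "set us = {z \<in> diagram lam \<alpha>. before z x}"
    unfolding D by (rule sorted_before_split(1)[OF sorted_reading_order[of lam \<alpha>, unfolded split(1)]])
  moreover have "x \<in> diagram lam \<alpha>" unfolding D by simp
  ultimately show ?thesis using split by blast
qed

section \<open>The highest weight tableau is a tableau\<close>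

lemma highest_tableau_extensional: "highest_tableau lam \<alpha> \<in> extensional (diagram lam \<alpha>)"
  by (auto simp: extensional_def highest_tableau_def diagram_def)

lemma highest_tableau_body: "(r, c) \<in> body lam \<Longrightarrow>
    highest_tableau lam \<alpha> (r, c) = of_nat r - of_nat (length lam)"
  by (simp add: highest_tableau_def)

lemma highest_tableau_tail: "k < length \<alpha> \<Longrightarrow> j < \<alpha> ! k \<Longrightarrow>
    highest_tableau lam \<alpha> (length lam + k, tail_col \<alpha> k + j) = tail_entry \<alpha> k j"
  by (simp add: highest_tableau_def body_iff ribbon_iff)

lemma tail_entry_half: "2 * tail_entry \<alpha> k j \<in> \<int> \<and> 1/2 \<le> tail_entry \<alpha> k j"
proof (induction \<alpha> k j rule: tail_entry.induct)
  case (2 \<alpha> k j)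
  then show ?case by (auto simp: Let_def distrib_left)
next
  case (3 \<alpha> k)
  then show ?case by (auto simp: Let_def distrib_left)
qed simp

lemma tail_entry_row:
  assumes "j < j'"
  shows "tail_entry \<alpha> k j \<le> tail_entry \<alpha> k j' \<and>
    (tail_entry \<alpha> k j \<notin> \<int> \<longrightarrow> tail_entry \<alpha> k j \<noteq> tail_entry \<alpha> k j')"
  using assms
proof (induction j')
  case (Suc j')
  have step: "tail_entry \<alpha> k j' \<le> tail_entry \<alpha> k (Suc j')"
    "tail_entry \<alpha> k j' \<notin> \<int> \<Longrightarrow> tail_entry \<alpha> k j' < tail_entry \<alpha> k (Suc j')"
    by (auto simp: Let_def)
  show ?case
  proof (cases "j = j'")
    case True
    then show ?thesis using step by auto
  next
    case False
    then have "tail_entry \<alpha> k j \<le> tail_entry \<alpha> k j' \<and>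
      (tail_entry \<alpha> k j \<notin> \<int> \<longrightarrow> tail_entry \<alpha> k j \<noteq> tail_entry \<alpha> k j')" using Suc by auto
    then show ?thesis using step by fastforce
  qed
qed simp

context tail_shape
begin

lemma tail_entry_column:
  assumes "k < k'" "k' < length \<alpha>" "j < \<alpha> ! k" "j' < \<alpha> ! k'"
  shows "tail_entry \<alpha> k j \<le> tail_entry \<alpha> k' j' \<and>
    (tail_entry \<alpha> k j \<in> \<int> \<longrightarrow> tail_entry \<alpha> k j \<noteq> tail_entry \<alpha> k' j')"
proof (rule ribbon_mono[where F = "tail_entry \<alpha>", OF _ _ tail_pos assms])
  show "tail_entry \<alpha> k j \<le> tail_entry \<alpha> k j'" if "j < j'" for k j j'
    using tail_entry_row[OF that] by blast
  show "tail_entry \<alpha> k (\<alpha> ! k - 1) \<le> tail_entry \<alpha> (Suc k) 0 \<and>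
      (tail_entry \<alpha> k (\<alpha> ! k - 1) \<in> \<int> \<longrightarrow> tail_entry \<alpha> k (\<alpha> ! k - 1) \<noteq> tail_entry \<alpha> (Suc k) 0)" for k
    by (auto simp: Let_def)
qed

text \<open>The body is negative and the tail is at least 1/2, so every condition linking the two is
  immediate; columns within the tail are left to \<open>tail_entry_column\<close>.\<close>

lemma highest_tableau_mem: "highest_tableau lam \<alpha> \<in> tableaux m lam \<alpha>"
proof -
  let ?H = "highest_tableau lam \<alpha>"
  have Hb: "?H (r, c) = of_nat r - of_nat m" if "(r, c) \<in> body lam" for r c
    using highest_tableau_body[OF that] length_lam by simp
  have Ht: "?H (m + k, tail_col \<alpha> k + j) = tail_entry \<alpha> k j" if "k < length \<alpha>" "j < \<alpha> ! k" for k j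
    using highest_tableau_tail[OF that, of lam] length_lam by simp
  have body_mem: "?H x \<in> letters m \<and> ?H x \<in> \<int> \<and> ?H x < 0" if xb: "x \<in> body lam" for x
  proof -
    obtain r c where x: "x = (r, c)" "r < m" using xb by (cases x) (auto simp: body_iff length_lam)
    then have "of_nat (Suc r) \<le> (of_nat m :: rat)" by (simp only: of_nat_le_iff)
    then show ?thesis using Hb xb x by (simp add: letters_def)
  qed
  have tail_mem: "?H x \<in> letters m \<and> 1/2 \<le> ?H x" if x: "x \<in> ribbon lam \<alpha>" for x
  proof -
    obtain k j where "k < length \<alpha>" "j < \<alpha> ! k" "x = (m + k, tail_col \<alpha> k + j)"
      using x by (rule ribbonE)
    then show ?thesis using Ht tail_entry_half[of \<alpha> k j] by (auto intro: letters_posI)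
  qed
  have joint: "?H (m, 0) = 1/2" if "\<alpha> \<noteq> []"
    using Ht[of 0 0] tail_pos[of 0] that by (simp add: tail_col_def)
  have "?H x \<in> letters m" if "x \<in> \<D>" for x
    using body_mem[of x] tail_mem[of x] diagram_cases[OF that] by blast
  then have "?H \<in> \<D> \<rightarrow>\<^sub>E letters m"
    using highest_tableau_extensional by (simp add: PiE_iff)
  moreover have "semistandard \<D> ?H"
    unfolding semistandard_def
  proof (rule conjI; intro allI impI)
    fix r c c' assume *: "(r, c) \<in> \<D> \<and> (r, c') \<in> \<D> \<and> c < c'"
    show "?H (r, c) \<le> ?H (r, c') \<and> (?H (r, c) \<notin> \<int> \<longrightarrow> ?H (r, c) \<noteq> ?H (r, c'))"
    proof (cases "r < m")
      case True
      then have "(r, c) \<in> body lam" "(r, c') \<in> body lam"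
        using * by (auto simp: diagram_def ribbon_iff length_lam)
      then show ?thesis using Hb by simp
    next
      case False
      then have "(r, c) \<in> ribbon lam \<alpha>" "(r, c') \<in> ribbon lam \<alpha>"
        using * by (auto simp: diagram_def body_iff length_lam)
      then obtain k j j' where "k < length \<alpha>" "j < \<alpha> ! k" "j' < \<alpha> ! k" "r = m + k"
        "c = tail_col \<alpha> k + j" "c' = tail_col \<alpha> k + j'"
        by (auto elim!: ribbonE)
      then show ?thesis using Ht tail_entry_row[of j j' \<alpha> k] * by simp
    qed
  next
    fix r r' c assume *: "(r, c) \<in> \<D> \<and> (r', c) \<in> \<D> \<and> r < r'"
    show "?H (r, c) \<le> ?H (r', c) \<and> (?H (r, c) \<in> \<int> \<longrightarrow> ?H (r, c) \<noteq> ?H (r', c))"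
    proof (cases "r < m")
      case True
      then have r: "(r, c) \<in> body lam"
        using * by (auto simp: diagram_def ribbon_iff length_lam)
      then consider "(r', c) \<in> body lam" | "(r', c) \<in> ribbon lam \<alpha>" using * diagram_cases by blast
      then show ?thesis
      proof cases
        case 1
        have "(of_nat r :: rat) < of_nat r'" using * by simp
        then show ?thesis using Hb r 1 by simp
      next
        case 2
        then show ?thesis using tail_mem[OF 2] body_mem[OF r] by auto
      qed
    next
      case False
      then have "(r, c) \<in> ribbon lam \<alpha>" "(r', c) \<in> ribbon lam \<alpha>"
        using * by (auto simp: diagram_def body_iff length_lam)
      then obtain k j k' j' where "k < length \<alpha>" "j < \<alpha> ! k" "k' < length \<alpha>" "j' < \<alpha> ! k'"
        and rc: "(r, c) = (m + k, tail_col \<alpha> k + j)" "(r', c) = (m + k', tail_col \<alpha> k' + j')"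
        by (elim ribbonE) blast
      moreover have "k < k'" using rc * by simp
      ultimately show ?thesis using Ht tail_entry_column[of k k' j j'] unfolding rc by simp
    qed
  qed
  moreover have "?H x < ?H (m, 0)" if "\<alpha> \<noteq> []" "x \<in> body lam" for x
    using body_mem[OF that(2)] joint[OF that(1)] by linarith
  ultimately show ?thesis unfolding tableaux_def Let_def length_lam by (simp add: less_imp_le)
qed

section \<open>Tableaux on which all raising operators vanish\<close>

context
  fixes T
  assumes T: "T \<in> tableaux m lam \<alpha>"
    and source: "\<And>i. i \<in> indices m \<Longrightarrow> ce (word_crystal m) i (reading_word lam \<alpha> T) = None"
begin

lemma source_not_target:
  assumes "i \<in> indices m" "acts_on lam \<alpha> i T x"
  shows "T x \<noteq> root_target i"
proof
  assume "T x = root_target i"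
  moreover obtain us vs where split: "reading_order lam \<alpha> = us @ x # vs"
    and acts: "acts_at i (map T us) (map T vs)" using assms(2) unfolding acts_on_def by blast
  ultimately have "ce (word_crystal m) i (reading_word lam \<alpha> T) =
      Some (map T us @ root_source i # map T vs)"
    unfolding word_e_iff[OF assms(1)] reading_word_split(1)[OF split] by auto
  then show False using source[OF assms(1)] by simp
qed

text \<open>The first violation \<open>x\<close> exceeds its row value \<open>r1 - m\<close>, so
  \<open>i = T x\<close> is an index, with \<open>root_target i = i\<close>. The negative entries
  before \<open>x\<close> are correct and come from higher rows, hence lie below
  \<open>i - 1\<close>. Neither letter occurs in front of \<open>x\<close>, and \<open>ceps\<close>
  is positive.\<close>

lemma source_entry_neg:
  assumes "(r, c) \<in> \<D>" "T (r, c) < 0"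
  shows "T (r, c) = of_nat r - of_nat m"
proof (rule ccontr)
  let ?P = "\<lambda>x. T x < 0 \<and> T x \<noteq> of_nat (fst x) - of_nat m"
  assume "T (r, c) \<noteq> of_nat r - of_nat m"
  then have "?P (r, c)" using assms(2) by simp
  with assms(1) obtain us x vs where split: "reading_order lam \<alpha> = us @ x # vs" and Px: "?P x"
    and xD: "x \<in> \<D>" and first: "\<forall>z\<in>\<D>. before z x \<longrightarrow> \<not> ?P z"
    and us: "set us = {z \<in> \<D>. before z x}"
    using first_cell[of "(r, c)" lam \<alpha> ?P] by blast
  obtain r1 c1 where x: "x = (r1, c1)" by (cases x)
  define i where "i = T x"
  have i: "i \<in> \<int>" "i \<le> -1" "i < 0" using letters_neg[OF entry_mem[OF T xD]] Px by (auto simp: i_def)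
  have xb: "(r1, c1) \<in> body lam" using neg_in_body[OF T xD] Px x by simp
  have D: "(r', c1) \<in> \<D>" if "r' \<le> r1" for r'
    using body_closed[OF xb that, of c1] body_subset by auto
  have "r1 \<le> m" using xb by (simp add: body_iff length_lam)
  then have "of_nat r1 - of_nat m \<le> i" using entry_ge[OF T _ D] x by (simp add: i_def)
  then have less: "of_nat r1 - of_nat m < i" using Px x by (simp add: i_def)
  moreover have "(of_nat r1 :: rat) - of_nat m \<in> \<int>" by simp
  ultimately have ge: "of_nat r1 - of_nat m + 1 \<le> i" using Ints_less_iff i(1) by blast
  then have im: "i \<in> indices m" using i by (auto simp: indices_def)
  have st: "root_target i = i" "root_source i = i - 1" using i by (auto simp: root_target_def root_source_def)
  have Tx: "T x = root_target i" using st by (simp add: i_def)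
  have *: "T y \<noteq> i" "T y \<noteq> i - 1" if y: "y \<in> \<D>" "before y x" for y
  proof -
    obtain r' c' where y': "y = (r', c')" by (cases y)
    have "T y < i - 1 \<or> T y \<ge> i" if "T y < 0"
    proof -
      have Ty: "T y = of_nat r' - of_nat m" using bspec[OF first y(1)] y(2) that y' by simp
      have "r' \<noteq> r1"
      proof
        assume "r' = r1"
        then have "(r1, c1) \<in> \<D>" "(r1, c') \<in> \<D>" "c1 < c'" using y y' x xD by auto
        then have "T x \<le> T y" using row_le[OF T] x y' \<open>r' = r1\<close> by simp
        then show False using Ty less \<open>r' = r1\<close> by (simp add: i_def)
      qed
      then have "Suc r' \<le> r1" using y y' x by auto
      then have "of_nat (Suc r') \<le> (of_nat r1 :: rat)" by (simp only: of_nat_le_iff)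
      then show ?thesis using Ty ge by simp
    qed
    moreover have "T y < i" if "T y < 0"
    proof -
      have "T y = of_nat r' - of_nat m" using bspec[OF first y(1)] y(2) that y' by simp
      moreover have "(of_nat r' :: rat) \<le> of_nat r1" using y y' x by auto
      ultimately show ?thesis using less by simp
    qed
    ultimately show "T y \<noteq> i" "T y \<noteq> i - 1" using i by force+
  qed
  have "b \<notin> set (map T us)" if "b = i \<or> b = i - 1" for b
  proof
    assume "b \<in> set (map T us)"
    then obtain y where "y \<in> set us" "b = T y" by auto
    then show False using *[of y] that us by simp
  qed
  then have "root_source i \<notin> set (map T us)" "root_target i \<notin> set (map T us)" using st by metis+
  from eps_append_eq[OF im i(3) this, of "root_target i # map T vs"]
  have "ceps (word_crystal m) i (reading_word lam \<alpha> T) \<noteq> 0"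
    unfolding reading_word_split(1)[OF split] Tx by (simp add: eps_Cons_neg[OF im i(3)])
  then show False using e_eq_None_imp_eps_eq_0[OF im i(3) source[OF im]] by simp
qed

text \<open>\<open>T x\<close> is the target of the root with index \<open>T x - 1/2\<close>; were
  its source absent, \<open>isotropic_e_neq_None\<close> would apply.\<close>

lemma source_no_gap:
  assumes "x \<in> \<D>" "1/2 < T x"
  shows "\<exists>y\<in>\<D>. T y = T x - 1/2"
proof (rule ccontr)
  assume *: "\<not> ?thesis"
  define i where "i = T x - 1/2"
  have "2 * T x \<in> \<int>" using letters_double_Ints[OF entry_mem[OF T assms(1)]] .
  then have "2 * T x - 1 \<in> \<int>" by simp
  then have i: "0 < i" "i \<in> indices m" using assms(2) by (auto simp: i_def indices_def right_diff_distrib)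
  have st: "root_source i = i" "root_target i = T x" using i(1) by (auto simp: root_source_def root_target_def i_def)
  have "set (reading_word lam \<alpha> T) = T ` \<D>"
    by (simp add: reading_word_def set_reading_order)
  then have "root_target i \<in> set (reading_word lam \<alpha> T)" "root_source i \<notin> set (reading_word lam \<alpha> T)"
    using assms(1) * st by (auto simp: i_def)
  from isotropic_e_neq_None[OF i(2) less_imp_le[OF i(1)] this] show False
    using source[OF i(2)] by blast
qed

lemma source_half:
  assumes "x \<in> \<D>" "0 < T x"
  shows "\<exists>y\<in>\<D>. T y = 1/2"
proof -
  let ?A = "{T y | y. y \<in> \<D> \<and> 0 < T y}"
  have fin: "finite ?A" by (rule finite_subset[of _ "T ` \<D>"]) (auto simp: finite_diagram)
  moreover have "T x \<in> ?A" using assms by blast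
  ultimately have "Min ?A \<in> ?A" using Min_in by blast
  then obtain y where y: "y \<in> \<D>" "0 < T y" "T y = Min ?A" by auto
  have "T y = 1/2"
  proof (rule ccontr)
    assume "T y \<noteq> 1/2"
    then have gt: "1/2 < T y" using letters_pos_ge[OF entry_mem[OF T y(1)] y(2)] by simp
    then obtain z where z: "z \<in> \<D>" "T z = T y - 1/2" using source_no_gap y(1) by blast
    moreover from this have "0 < T z" using gt by simp
    ultimately have "T z \<in> ?A" by blast
    then show False using Min_le[OF fin, of "T z"] z(2) y(3) by simp
  qed
  then show ?thesis using y(1) by blast
qed

text \<open>At the first node \<open>z\<close> carrying -1 or 1/2, \<open>e\<^sub>0\<close> would
  act on 1/2; so \<open>z\<close> carries -1 and lies in the last row of the body. A 1/2 in the body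
  would come later in that row, to the left of \<open>z\<close>, against the row order. So 1/2
  occurs in the tail, the joint is at most 1/2, and the body, bounded by the joint, has no positive
  letter left.\<close>

lemma source_body_neg:
  assumes "x \<in> body lam"
  shows "T x < 0"
proof (rule ccontr)
  assume "\<not> T x < 0"
  moreover have xD: "x \<in> \<D>" using assms body_subset by auto
  ultimately have pos: "0 < T x" using letters_neg[OF entry_mem[OF T xD]] by force
  obtain h where h: "h \<in> \<D>" "T h = 1/2" using source_half[OF xD pos] by blast
  have "1 \<le> m" using assms by (cases x) (simp add: body_iff length_lam)
  then have i: "0 \<in> indices m" by (simp add: indices_def)
  have st: "root_source 0 = -1" "root_target 0 = 1/2" by (auto simp: root_source_def root_target_def)
  let ?P = "\<lambda>y. T y = -1 \<or> T y = 1/2"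
  have "?P h" using h by simp
  with h(1) obtain us z vs where z: "?P z" "z \<in> \<D>" "\<forall>y\<in>\<D>. before y z \<longrightarrow> \<not> ?P y"
    using first_cell[of h lam \<alpha> ?P] by blast
  have "acts_on lam \<alpha> 0 T z"
    unfolding acts_on_nonneg_iff[OF order.refl z(2)] using z(3) st by auto
  then have Tz: "T z = -1" using source_not_target[OF i] st z(1) by auto
  obtain r c where rc: "z = (r, c)" by (cases z)
  then have "of_nat (Suc r) = (of_nat m :: rat)" using source_entry_neg[of r c] z(2) Tz by simp
  then have r: "Suc r = m" using of_nat_eq_iff by blast
  have no_half: "T y \<noteq> 1/2" if y: "y \<in> body lam" for y
  proof
    assume Ty: "T y = 1/2"
    obtain r' c' where y': "y = (r', c')" by (cases y)
    have yD: "y \<in> \<D>" using y body_subset by auto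
    have "y \<noteq> z" using Ty Tz by auto
    then have "before z y" using z(3) yD Ty before_linear by blast
    then have "r' = r" "c' < c" using y y' rc r by (auto simp: body_iff length_lam)
    then have "T y \<le> T z" using row_le[OF T, of r c' c] yD z(2) y' rc by simp
    then show False using Ty Tz by simp
  qed
  then have hr: "h \<in> ribbon lam \<alpha>" using h diagram_cases by blast
  then have \<alpha>: "\<alpha> \<noteq> []" by (auto simp: ribbon_def)
  have "T (m, 0) \<le> 1/2" using joint_le_tail[OF T hr] h(2) by simp
  then have "T x \<le> 1/2" using body_le_joint(1)[OF T \<alpha> assms] by simp
  then show False using no_half[OF assms] letters_pos_ge[OF entry_mem[OF T xD] pos] by simp
qed

text \<open>After a larger jump the letter \<open>T y - 1/2\<close> would have to occur by
  \<open>source_no_gap\<close>, but the body is negative and no tail entry lies strictly between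
  \<open>T x\<close> and \<open>T y\<close>.\<close>

lemma source_tail_step:
  assumes "x \<in> ribbon lam \<alpha>" "y \<in> ribbon lam \<alpha>" "T x \<le> T y"
    and "\<And>z. z \<in> ribbon lam \<alpha> \<Longrightarrow> T z \<le> T x \<or> T y \<le> T z"
  shows "T y = T x \<or> T y = T x + 1/2"
proof (rule ccontr)
  assume *: "\<not> ?thesis"
  have D: "x \<in> \<D>" "y \<in> \<D>" using assms(1,2) ribbon_subset by auto
  have "T x + 1/2 \<le> T y"
    using double_Ints_less_iff[OF letters_double_Ints letters_double_Ints, OF entry_mem[OF T D(1)]
      entry_mem[OF T D(2)]] assms(3) * by auto
  then have less: "T x < T y - 1/2" using * by simp
  have "0 < T x" using tail_entry_pos[OF T assms(1)] .
  then obtain z where z: "z \<in> \<D>" "T z = T y - 1/2" using source_no_gap[OF D(2)] less by force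
  then have "0 < T z" using less \<open>0 < T x\<close> by simp
  then have "z \<in> ribbon lam \<alpha>" using source_body_neg[of z] diagram_cases[OF z(1)] by force
  then show False using assms(4)[of z] z(2) less by simp
qed

text \<open>The root with positive index \<open>a\<close> joins \<open>a\<close> and
  \<open>a + 1/2\<close>. As the body is negative, it is decided in the tail alone whether
  \<open>e\<^sub>a\<close> acts at \<open>x\<close>.\<close>

lemma source_tail_not_succ:
  assumes "x \<in> ribbon lam \<alpha>" "a \<in> letters m" "0 < a"
    and "\<And>z. z \<in> ribbon lam \<alpha> \<Longrightarrow> (if a \<in> \<int> then before z x else before x z) \<Longrightarrow>
      T z \<noteq> a \<and> T z \<noteq> a + 1/2"
  shows "T x \<noteq> a + 1/2"
proof -
  have i: "a \<in> indices m" using assms(2,3) letters_double_Ints by (auto simp: indices_def)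
  have st: "root_source a = a" "root_target a = a + 1/2" using assms(3) by (auto simp: root_source_def root_target_def)
  have xD: "x \<in> \<D>" using assms(1) ribbon_subset by auto
  have "acts_on lam \<alpha> a T x"
    unfolding acts_on_nonneg_iff[OF less_imp_le[OF assms(3)] xD] st
  proof (intro ballI impI)
    fix y assume y: "y \<in> \<D>" "if a \<in> \<int> then before y x else before x y"
    show "T y \<noteq> a \<and> T y \<noteq> a + 1/2"
    proof (cases "y \<in> body lam")
      case True
      then show ?thesis using source_body_neg[OF True] assms(3) by auto
    next
      case False
      then show ?thesis using y assms(4) diagram_cases by blast
    qed
  qed
  then show ?thesis using source_not_target[OF i] st by simp
qed

text \<open>For odd \<open>T ?x\<close> the increase is forced. Suppose \<open>T ?x\<close> is even
  and \<open>T ?y\<close> the next letter. The tail nodes read before \<open>?y\<close> are those of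
  earlier tail rows, strictly below \<open>T ?x\<close>, and those to the right of
  \<open>?y\<close>, strictly above the odd \<open>T ?y\<close>. So \<open>?y\<close> could be
  raised.\<close>

lemma source_tail_right:
  assumes k: "k < length \<alpha>" and j: "Suc j < \<alpha> ! k"
  shows "T (m + k, tail_col \<alpha> k + Suc j) = (let a = T (m + k, tail_col \<alpha> k + j) in
    if a \<in> \<int> then a else a + 1/2)"
proof -
  let ?x = "(m + k, tail_col \<alpha> k + j)" and ?y = "(m + k, tail_col \<alpha> k + Suc j)"
  have x: "?x \<in> ribbon lam \<alpha>" "?x \<in> \<D>" and y: "?y \<in> ribbon lam \<alpha>" "?y \<in> \<D>"
    using ribbonI k j ribbon_subset by (auto simp del: add_Suc_right)
  have le: "T ?x \<le> T ?y" and less: "T ?x \<notin> \<int> \<Longrightarrow> T ?x < T ?y"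
    using row_le[OF T x(2) y(2)] row_less[OF T x(2) y(2)] by auto
  have split: "(T z \<le> T ?x \<and> (before z ?y \<longrightarrow> T ?x \<in> \<int> \<longrightarrow> T z < T ?x)) \<or>
      (T ?y \<le> T z \<and> (before z ?y \<longrightarrow> T ?y \<notin> \<int> \<longrightarrow> T ?y < T z))" if z: "z \<in> ribbon lam \<alpha>" for z
  proof -
    obtain k' j' where z': "k' < length \<alpha>" "j' < \<alpha> ! k'" "z = (m + k', tail_col \<alpha> k' + j')"
      using z by (rule ribbonE)
    consider "k' < k" | "k' = k" "j' \<le> j" | "k' = k" "Suc j \<le> j'" | "k < k'" by linarith
    then show ?thesis
    proof cases
      case 1
      then show ?thesis using tail_entry_mono[OF T 1 k z'(2), of j] j z' by auto
    next
      case 2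
      then show ?thesis using row_le[OF T _ x(2), of "tail_col \<alpha> k + j'"] z' z ribbon_subset by auto
    next
      case 3
      then have "z = (m + k, tail_col \<alpha> k + j')" "z \<in> \<D>" using z' z ribbon_subset by auto
      then show ?thesis
        using row_le[OF T y(2), of "tail_col \<alpha> k + j'"] row_less[OF T y(2), of "tail_col \<alpha> k + j'"] 3
        by auto
    next
      case 4
      then show ?thesis using tail_entry_mono[OF T 4 z'(1) j z'(2)] z' by auto
    qed
  qed
  have step: "T ?y = T ?x \<or> T ?y = T ?x + 1/2"
    using source_tail_step[OF x(1) y(1) le] split by blast
  have "T ?y \<noteq> T ?x + 1/2" if "T ?x \<in> \<int>"
  proof
    assume eq: "T ?y = T ?x + 1/2"
    then have "T ?y \<notin> \<int>" using not_Ints_add_half that by simp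
    have "T ?y \<noteq> T ?x + 1/2"
      using entry_mem[OF T x(2)] tail_entry_pos[OF T x(1)]
    proof (rule source_tail_not_succ[OF y(1)])
      fix z assume z: "z \<in> ribbon lam \<alpha>" "if T ?x \<in> \<int> then before z ?y else before ?y z"
      then show "T z \<noteq> T ?x \<and> T z \<noteq> T ?x + 1/2"
        using split[OF z(1)] that eq \<open>T ?y \<notin> \<int>\<close> by auto
    qed
    then show False using eq by simp
  qed
  then show ?thesis using step less by (auto simp: Let_def)
qed

text \<open>Parities, and before and after, are exchanged. Since \<open>?y\<close> begins its row,
  only later rows are read after it, and these are strictly above \<open>T ?y\<close> if that is
  even.\<close>

lemma source_tail_below:
  assumes k: "Suc k < length \<alpha>"
  shows "T (m + Suc k, tail_col \<alpha> (Suc k) + 0) = (let a = T (m + k, tail_col \<alpha> k + (\<alpha> ! k - 1)) in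
    if a \<notin> \<int> then a else a + 1/2)"
proof -
  let ?x = "(m + k, tail_col \<alpha> k + (\<alpha> ! k - 1))" and ?y = "(m + Suc k, tail_col \<alpha> (Suc k) + 0)"
  have k': "k < length \<alpha>" "\<alpha> ! k - 1 < \<alpha> ! k" "0 < \<alpha> ! Suc k" using k tail_pos[of k] tail_pos[of "Suc k"] by auto
  have x: "?x \<in> ribbon lam \<alpha>" "?x \<in> \<D>" and y: "?y \<in> ribbon lam \<alpha>" "?y \<in> \<D>"
    using ribbonI[OF k'(1,2)] ribbonI[OF k k'(3)] ribbon_subset by auto
  have le: "T ?x \<le> T ?y" and less: "T ?x \<in> \<int> \<Longrightarrow> T ?x < T ?y"
    using tail_entry_mono[OF T lessI k k'(2,3)] by auto
  have split: "(T z \<le> T ?x \<and> \<not> before ?y z) \<or>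
      (T ?y \<le> T z \<and> (before ?y z \<longrightarrow> T ?y \<in> \<int> \<longrightarrow> T ?y < T z))" if z: "z \<in> ribbon lam \<alpha>" for z
  proof -
    obtain l j where z': "l < length \<alpha>" "j < \<alpha> ! l" "z = (m + l, tail_col \<alpha> l + j)"
      using z by (rule ribbonE)
    consider "l < k" | "l = k" | "l = Suc k" | "Suc k < l" by linarith
    then show ?thesis
    proof cases
      case 1
      then show ?thesis using tail_entry_mono[OF T 1 k'(1) z'(2) k'(2)] z' by auto
    next
      case 2
      then show ?thesis
        using row_le[OF T _ x(2), of "tail_col \<alpha> k + j"] z' z ribbon_subset by (auto simp: tail_col_def)
    next
      case 3
      then have "z = (m + Suc k, tail_col \<alpha> (Suc k) + j)" "z \<in> \<D>" using z' z ribbon_subset by auto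
      then show ?thesis using row_le[OF T y(2), of "tail_col \<alpha> (Suc k) + j"] by auto
    next
      case 4
      then show ?thesis using tail_entry_mono[OF T 4 z'(1) k'(3) z'(2)] z' by auto
    qed
  qed
  have step: "T ?y = T ?x \<or> T ?y = T ?x + 1/2"
    using source_tail_step[OF x(1) y(1) le] split by blast
  have "T ?y \<noteq> T ?x + 1/2" if "T ?x \<notin> \<int>"
  proof
    assume eq: "T ?y = T ?x + 1/2"
    then have "T ?y \<in> \<int>"
      using Ints_add_half[OF letters_double_Ints[OF entry_mem[OF T x(2)]]] that by simp
    have "T ?y \<noteq> T ?x + 1/2"
      using entry_mem[OF T x(2)] tail_entry_pos[OF T x(1)]
    proof (rule source_tail_not_succ[OF y(1)])
      fix z assume z: "z \<in> ribbon lam \<alpha>" "if T ?x \<in> \<int> then before z ?y else before ?y z"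
      then show "T z \<noteq> T ?x \<and> T z \<noteq> T ?x + 1/2"
        using split[OF z(1)] that eq \<open>T ?y \<in> \<int>\<close> by auto
    qed
    then show False using eq by simp
  qed
  then show ?thesis using step less by (auto simp: Let_def)
qed

lemma source_joint:
  assumes "\<alpha> \<noteq> []"
  shows "T (m, 0) = 1/2"
proof -
  have joint: "(m, 0) \<in> \<D>" using joint_mem[OF assms] ribbon_subset by auto
  obtain y where y: "y \<in> \<D>" "T y = 1/2" using source_half[OF joint joint_pos[OF T assms]] by blast
  then have "y \<notin> body lam" using source_body_neg[of y] by auto
  then have "T (m, 0) \<le> 1/2" using joint_le_tail[OF T, of y] diagram_cases[OF y(1)] y(2) by auto
  then show ?thesis using letters_pos_ge[OF entry_mem[OF T joint] joint_pos[OF T assms]] by simp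
qed

lemma source_tail:
  "k < length \<alpha> \<Longrightarrow> j < \<alpha> ! k \<Longrightarrow> T (m + k, tail_col \<alpha> k + j) = tail_entry \<alpha> k j"
proof (induction k arbitrary: j)
  case 0
  then have "\<alpha> \<noteq> []" by auto
  from 0(2) show ?case
  proof (induction j)
    case 0
    then show ?case using source_joint[OF \<open>\<alpha> \<noteq> []\<close>] by (simp add: tail_col_def)
  next
    case (Suc j)
    then show ?case using source_tail_right[of 0 j] \<open>\<alpha> \<noteq> []\<close> by (simp del: add_Suc_right)
  qed
next
  case (Suc k)
  note k = Suc.prems(1)
  from Suc.prems(2) show ?case
  proof (induction j)
    case 0
    have "T (m + k, tail_col \<alpha> k + (\<alpha> ! k - 1)) = tail_entry \<alpha> k (\<alpha> ! k - 1)"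
      using Suc.IH[of "\<alpha> ! k - 1"] Suc.prems(1) tail_pos[of k] by (simp del: add_diff_assoc)
    then show ?case using source_tail_below[OF Suc.prems(1)] by (simp del: add_Suc_right)
  next
    case (Suc j)
    then show ?case using source_tail_right[OF k, of j] k
      by (simp del: add_Suc_right)
  qed
qed

lemma source_eq_highest: "T = highest_tableau lam \<alpha>"
proof (rule extensionalityI)
  show "T \<in> extensional \<D>" using extensional[OF T] .
  show "highest_tableau lam \<alpha> \<in> extensional \<D>" by (rule highest_tableau_extensional)
  show "T x = highest_tableau lam \<alpha> x" if x: "x \<in> \<D>" for x
  proof (cases "x \<in> body lam")
    case True
    then show ?thesis
      using source_body_neg[OF True] source_entry_neg x highest_tableau_body length_lam
      by (cases x) auto
  next
    case False
    then have "x \<in> ribbon lam \<alpha>" using diagram_cases[OF x] by blast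
    then obtain k j where "k < length \<alpha>" "j < \<alpha> ! k" "x = (m + k, tail_col \<alpha> k + j)" by (rule ribbonE)
    then show ?thesis using source_tail highest_tableau_tail length_lam by metis
  qed
qed

end

end

section \<open>Crystals generated by one element\<close>

lemma weight_ge_refl: "weight_ge m p p"
  unfolding weight_ge_def by (intro exI[of _ 0]) simp

lemma sum_keys_superset:
  fixes c :: "rat \<Rightarrow>\<^sub>0 nat"
  assumes "finite A" "Poly_Mapping.keys c \<subseteq> A"
  shows "(\<Sum>i\<in>Poly_Mapping.keys c. frag_cmul (int (Poly_Mapping.lookup c i)) (simple_root i)) =
    (\<Sum>i\<in>A. frag_cmul (int (Poly_Mapping.lookup c i)) (simple_root i))"
  by (rule sum.mono_neutral_left) (use assms in \<open>auto simp: in_keys_iff\<close>)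

lemma weight_ge_minus_simple_root:
  assumes "weight_ge m p q" "i \<in> indices m"
  shows "weight_ge m p (q - simple_root i)"
proof -
  obtain c :: "rat \<Rightarrow>\<^sub>0 nat" where c: "Poly_Mapping.keys c \<subseteq> indices m"
    "p - q = (\<Sum>j\<in>Poly_Mapping.keys c. frag_cmul (int (Poly_Mapping.lookup c j)) (simple_root j))"
    using assms(1) unfolding weight_ge_def by blast
  \<comment> \<open>The sums are compared over \<open>?A\<close>, as \<open>i\<close> may or may not
    be a key of \<open>c\<close>.\<close>
  let ?c = "c + Poly_Mapping.single i 1" and ?A = "insert i (Poly_Mapping.keys c)"
  have keys: "Poly_Mapping.keys ?c \<subseteq> ?A"
    using keys_add[of c "Poly_Mapping.single i 1"] by auto
  have "(\<Sum>j\<in>Poly_Mapping.keys ?c. frag_cmul (int (Poly_Mapping.lookup ?c j)) (simple_root j)) =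
      (\<Sum>j\<in>?A. frag_cmul (int (Poly_Mapping.lookup ?c j)) (simple_root j))"
    by (rule sum_keys_superset) (use keys in auto)
  also have "\<dots> = (\<Sum>j\<in>?A. frag_cmul (int (Poly_Mapping.lookup c j)) (simple_root j) +
      (if j = i then simple_root i else 0))"
    by (rule sum.cong) (auto simp: lookup_add lookup_single frag_cmul_distrib)
  also have "\<dots> = (\<Sum>j\<in>?A. frag_cmul (int (Poly_Mapping.lookup c j)) (simple_root j)) + simple_root i"
    by (simp add: sum.distrib sum.delta)
  also have "\<dots> = p - q + simple_root i"
    unfolding c(2) by (subst sum_keys_superset[of ?A]) auto
  finally have "p - (q - simple_root i) =
      (\<Sum>j\<in>Poly_Mapping.keys ?c. frag_cmul (int (Poly_Mapping.lookup ?c j)) (simple_root j))"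
    by simp
  moreover have "Poly_Mapping.keys ?c \<subseteq> indices m" using keys c(1) assms(2) by auto
  ultimately show ?thesis unfolding weight_ge_def by blast
qed

text \<open>
  Negative on every simple root, so it strictly increases whenever some \<open>f\<^sub>i\<close> is applied; hence a highest
  weight element is reached from itself only by the empty string.
\<close>

definition depth :: "weight \<Rightarrow> rat" where
  "depth p = (\<Sum>b\<in>Poly_Mapping.keys p. of_int (Poly_Mapping.lookup p b) * b)"

lemma depth_superset:
  assumes "finite A" "Poly_Mapping.keys p \<subseteq> A"
  shows "depth p = (\<Sum>b\<in>A. of_int (Poly_Mapping.lookup p b) * b)"
  unfolding depth_def by (rule sum.mono_neutral_left) (use assms in \<open>auto simp: in_keys_iff\<close>)

lemma depth_add: "depth (p + q) = depth p + depth q"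
proof -
  let ?A = "Poly_Mapping.keys p \<union> Poly_Mapping.keys q"
  have "depth (p + q) = (\<Sum>b\<in>?A. of_int (Poly_Mapping.lookup (p + q) b) * b)"
    using keys_add[of p q] by (intro depth_superset) auto
  also have "\<dots> = depth p + depth q"
    by (simp add: depth_superset[of ?A] lookup_add distrib_right sum.distrib)
  finally show ?thesis .
qed

lemma depth_frag_cmul: "depth (frag_cmul n p) = of_int n * depth p"
proof -
  have "depth (frag_cmul n p) =
      (\<Sum>b\<in>Poly_Mapping.keys p. of_int (Poly_Mapping.lookup (frag_cmul n p) b) * b)"
    using keys_cmul[of n p] by (intro depth_superset) auto
  then show ?thesis by (simp add: depth_def sum_distrib_left mult.assoc)
qed

lemma depth_minus: "depth (p - q) = depth p - depth q"
  using depth_add[of "p - q" q] by simp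

lemma depth_sum: "depth (sum g A) = (\<Sum>x\<in>A. depth (g x))"
  by (induction A rule: infinite_finite_induct) (simp_all add: depth_add, simp_all add: depth_def)

lemma depth_frag_of: "depth (frag_of b) = b"
  by (simp add: depth_def)

text \<open>The smallest distance between the two letters of a simple root is 1/2.\<close>

lemma depth_simple_root_le: "depth (simple_root i) \<le> - (1/2)"
  using root_source_less_half[of i] by (simp add: simple_root_def depth_minus depth_frag_of)

lemma weight_ge_depth:
  assumes "weight_ge m p q"
  shows "depth p \<le> depth q"
proof -
  obtain c :: "rat \<Rightarrow>\<^sub>0 nat" where
    "p - q = (\<Sum>i\<in>Poly_Mapping.keys c. frag_cmul (int (Poly_Mapping.lookup c i)) (simple_root i))"
    using assms unfolding weight_ge_def by blast
  then have "depth p - depth q =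
      (\<Sum>i\<in>Poly_Mapping.keys c. of_nat (Poly_Mapping.lookup c i) * depth (simple_root i))"
    unfolding depth_minus[symmetric] by (simp add: depth_sum depth_frag_cmul)
  also have "\<dots> \<le> 0"
  proof (rule sum_nonpos)
    fix i
    have "depth (simple_root i) \<le> 0" using depth_simple_root_le[of i] by simp
    then show "of_nat (Poly_Mapping.lookup c i) * depth (simple_root i) \<le> 0"
      by (intro mult_nonneg_nonpos) auto
  qed
  finally show ?thesis by simp
qed

lemma f_string_Nil [simp]: "f_string B [] b = Some b"
  by (simp add: f_string_def)

lemma f_string_Cons [simp]: "f_string B (i # ks) b = Option.bind (f_string B ks b) (cf B i)"
  by (simp add: f_string_def)

lemma is_crystal_f:
  assumes "is_crystal m B" "i \<in> indices m" "b \<in> elems B" "cf B i b = Some b'"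
  shows "b' \<in> elems B" "cwt B b' = cwt B b - simple_root i"
proof -
  note * = bspec[OF bspec[OF conjunct2[OF assms(1)[unfolded is_crystal_def]] assms(2)] assms(3)]
  from * have "cf B i b \<in> insert None (Some ` elems B)" by (elim conjE)
  then show "b' \<in> elems B" using assms(4) by auto
  from * have "\<forall>b'. cf B i b = Some b' \<longrightarrow> int (ceps B i b') = int (ceps B i b) + 1 \<and>
    int (cphi B i b') = int (cphi B i b) - 1 \<and> cwt B b' = cwt B b - simple_root i"
    by (elim conjE)
  then show "cwt B b' = cwt B b - simple_root i" using assms(4) by simp
qed

lemma is_crystal_e:
  assumes "is_crystal m B" "i \<in> indices m" "b \<in> elems B" "ce B i b = Some b'"
  shows "b' \<in> elems B" "cf B i b' = Some b"
proof -
  note crystal = bspec[OF bspec[OF conjunct2[OF assms(1)[unfolded is_crystal_def]] assms(2)]]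
  from crystal[OF assms(3)] have "ce B i b \<in> insert None (Some ` elems B)" by (elim conjE)
  then show b': "b' \<in> elems B" using assms(4) by auto
  from crystal[OF b'] have "\<forall>b''\<in>elems B. cf B i b' = Some b'' \<longleftrightarrow> ce B i b'' = Some b'"
    by (elim conjE)
  then show "cf B i b' = Some b" using assms(3,4) by simp
qed

text \<open>Each operator subtracts a simple root and so adds at least 1/2 to the depth; the length
  of a string is thus bounded by the depth it gains.\<close>

lemma f_string_elems:
  assumes "is_crystal m B" "h \<in> elems B"
  shows "set ks \<subseteq> indices m \<Longrightarrow> f_string B ks h = Some b \<Longrightarrow>
    b \<in> elems B \<and> weight_ge m (cwt B h) (cwt B b) \<and>
    depth (cwt B h) + of_nat (length ks) / 2 \<le> depth (cwt B b) \<and> (h, b) \<in> (crystal_edges m B)\<^sup>*"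
proof (induction ks arbitrary: b)
  case Nil
  then show ?case using assms(2) by (simp add: weight_ge_refl)
next
  case (Cons i ks)
  then obtain b' where b': "f_string B ks h = Some b'" "cf B i b' = Some b"
    by (auto split: bind_splits)
  have i: "i \<in> indices m" and IH: "b' \<in> elems B" "weight_ge m (cwt B h) (cwt B b')"
    "depth (cwt B h) + of_nat (length ks) / 2 \<le> depth (cwt B b')"
    "(h, b') \<in> (crystal_edges m B)\<^sup>*"
    using Cons.IH[OF _ b'(1)] Cons.prems(1) by auto
  have b: "b \<in> elems B" "cwt B b = cwt B b' - simple_root i"
    using is_crystal_f[OF assms(1) i IH(1) b'(2)] by auto
  have "(b', b) \<in> crystal_edges m B"
    using IH(1) b(1) b'(2) i by (auto simp: crystal_edges_def)
  then have "(h, b) \<in> (crystal_edges m B)\<^sup>*" using IH(4) by (rule rtrancl_into_rtrancl[rotated])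
  moreover have "weight_ge m (cwt B h) (cwt B b)"
    unfolding b(2) using weight_ge_minus_simple_root[OF IH(2) i] .
  moreover have "depth (cwt B h) + of_nat (length (i # ks)) / 2 \<le> depth (cwt B b)"
    unfolding b(2) depth_minus using IH(3) depth_simple_root_le[of i] by (simp add: field_simps)
  ultimately show ?case using b(1) by blast
qed

text \<open>Connectedness and uniqueness follow formally from generation. Another highest weight
  element \<open>h'\<close> is reached from \<open>h\<close> by some string, but its depth is at
  most that of \<open>h\<close>, so the string is empty.\<close>

lemma generated_crystal:
  assumes "is_crystal m B" "h \<in> elems B"
    and generated: "\<And>b. b \<in> elems B \<Longrightarrow> \<exists>ks. set ks \<subseteq> indices m \<and> f_string B ks h = Some b"
  shows "Some ` elems B = {f_string B ks h | ks. set ks \<subseteq> indices m} - {None}"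
    and "crystal_connected m B"
    and "highest_weight_elems m B = {h}"
proof -
  note string = f_string_elems[OF assms(1,2)]
  show "Some ` elems B = {f_string B ks h | ks. set ks \<subseteq> indices m} - {None}"
  proof (intro equalityI subsetI)
    fix x assume "x \<in> Some ` elems B"
    then obtain b where "x = Some b" "b \<in> elems B" by blast
    then show "x \<in> {f_string B ks h | ks. set ks \<subseteq> indices m} - {None}"
      using generated[of b] by force
  next
    fix x assume "x \<in> {f_string B ks h | ks. set ks \<subseteq> indices m} - {None}"
    then obtain ks where ks: "set ks \<subseteq> indices m" "x = f_string B ks h" and "x \<noteq> None" by blast
    then obtain b where x: "x = Some b" by blast
    then have "f_string B ks h = Some b" using ks by simp
    then show "x \<in> Some ` elems B" using string[OF ks(1)] x by blast
  qed
  have reach: "(h, b) \<in> (crystal_edges m B)\<^sup>*" if "b \<in> elems B" for b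
    using generated[OF that] string by blast
  let ?E = "crystal_edges m B \<union> (crystal_edges m B)\<inverse>"
  show "crystal_connected m B"
    unfolding crystal_connected_def
  proof (intro conjI ballI)
    show "elems B \<noteq> {}" using assms(2) by blast
    fix b b' assume "b \<in> elems B" "b' \<in> elems B"
    then have "(b, h) \<in> ((crystal_edges m B)\<inverse>)\<^sup>*" "(h, b') \<in> (crystal_edges m B)\<^sup>*"
      using reach by (auto simp: rtrancl_converse)
    then have "(b, h) \<in> ?E\<^sup>*" "(h, b') \<in> ?E\<^sup>*"
      using rtrancl_mono[of "(crystal_edges m B)\<inverse>" ?E] rtrancl_mono[of "crystal_edges m B" ?E]
      by auto
    then show "(b, b') \<in> ?E\<^sup>*" by (rule rtrancl_trans)
  qed
  have "h \<in> highest_weight_elems m B"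
    unfolding highest_weight_elems_def using assms(2) generated string by blast
  moreover have "h' = h" if "h' \<in> highest_weight_elems m B" for h'
  proof -
    have h': "h' \<in> elems B" "weight_ge m (cwt B h') (cwt B h)"
      using that assms(2) by (auto simp: highest_weight_elems_def)
    then obtain ks where ks: "set ks \<subseteq> indices m" "f_string B ks h = Some h'"
      using generated by blast
    then have "depth (cwt B h) + of_nat (length ks) / 2 \<le> depth (cwt B h')" using string by blast
    moreover have "depth (cwt B h') \<le> depth (cwt B h)" using weight_ge_depth[OF h'(2)] .
    ultimately have "(of_nat (length ks) :: rat) / 2 \<le> 0" by linarith
    then have "ks = []" by simp
    then show ?thesis using ks(2) by simp
  qed
  ultimately show "highest_weight_elems m B = {h}" by blast
qed

section \<open>The crystal axioms for tableaux and generation\<close>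

lemma acts_on_upd [simp]: "acts_on lam \<alpha> i (T(x := b)) x \<longleftrightarrow> acts_on lam \<alpha> i T x"
proof -
  have "map (T(x := b)) us = map T us \<and> map (T(x := b)) vs = map T vs"
    if "reading_order lam \<alpha> = us @ x # vs" for us vs
    using distinct_sorted_before[OF sorted_reading_order[of lam \<alpha>]] that by auto
  then show ?thesis unfolding acts_on_def by metis
qed

lemma tableau_crystal_simps [simp]:
  "elems (tableau_crystal m lam \<alpha>) = tableaux m lam \<alpha>"
  "cwt (tableau_crystal m lam \<alpha>) T = cwt (word_crystal m) (reading_word lam \<alpha> T)"
  "ceps (tableau_crystal m lam \<alpha>) i T = ceps (word_crystal m) i (reading_word lam \<alpha> T)"
  "cphi (tableau_crystal m lam \<alpha>) i T = cphi (word_crystal m) i (reading_word lam \<alpha> T)"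
  "ce (tableau_crystal m lam \<alpha>) i T =
    map_option (filling_of_word lam \<alpha>) (ce (word_crystal m) i (reading_word lam \<alpha> T))"
  "cf (tableau_crystal m lam \<alpha>) i T =
    map_option (filling_of_word lam \<alpha>) (cf (word_crystal m) i (reading_word lam \<alpha> T))"
  by (simp_all add: tableau_crystal_def transport_def)

text \<open>Formulated for lowering; the axiom for raising follows by exchanging \<open>T\<close>
  and \<open>T'\<close>.\<close>

lemma acts_on_crystal_data:
  assumes "i \<in> indices m" "acts_on lam \<alpha> i T x" "T x = root_source i" "T' = T(x := root_target i)"
  shows "ceps (word_crystal m) i (reading_word lam \<alpha> T') =
      Suc (ceps (word_crystal m) i (reading_word lam \<alpha> T))"
    and "cphi (word_crystal m) i (reading_word lam \<alpha> T) =
      Suc (cphi (word_crystal m) i (reading_word lam \<alpha> T'))"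
    and "cwt (word_crystal m) (reading_word lam \<alpha> T') =
      cwt (word_crystal m) (reading_word lam \<alpha> T) - simple_root i"
proof -
  obtain us vs where split: "reading_order lam \<alpha> = us @ x # vs"
    and acts: "acts_at i (map T us) (map T vs)" using assms(2) unfolding acts_on_def by blast
  have words: "reading_word lam \<alpha> T = map T us @ root_source i # map T vs"
    "reading_word lam \<alpha> T' = map T us @ root_target i # map T vs"
    using reading_word_split[OF split] assms(3,4) by auto
  show "ceps (word_crystal m) i (reading_word lam \<alpha> T') =
      Suc (ceps (word_crystal m) i (reading_word lam \<alpha> T))"
    "cphi (word_crystal m) i (reading_word lam \<alpha> T) =
      Suc (cphi (word_crystal m) i (reading_word lam \<alpha> T'))"
    "cwt (word_crystal m) (reading_word lam \<alpha> T') =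
      cwt (word_crystal m) (reading_word lam \<alpha> T) - simple_root i"
    unfolding words using word_eps_phi_acts_at[OF assms(1) acts] cwt_acts_at[OF assms(1)] by auto
qed

context tail_shape
begin

abbreviation "\<B> \<equiv> tableau_crystal m lam \<alpha>"

lemma tableau_f_iff:
  assumes "T \<in> tableaux m lam \<alpha>" "i \<in> indices m"
  shows "cf \<B> i T = Some T' \<longleftrightarrow>
    (\<exists>x. acts_on lam \<alpha> i T x \<and> T x = root_source i \<and> T' = T(x := root_target i))"
  using word_operator_filling_iff[OF extensional[OF assms(1)] word_f_iff[OF assms(2)]] by simp

lemma tableau_e_iff:
  assumes "T \<in> tableaux m lam \<alpha>" "i \<in> indices m"
  shows "ce \<B> i T = Some T' \<longleftrightarrow>
    (\<exists>x. acts_on lam \<alpha> i T x \<and> T x = root_target i \<and> T' = T(x := root_source i))"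
  using word_operator_filling_iff[OF extensional[OF assms(1)] word_e_iff[OF assms(2)]] by simp

lemma tableau_is_crystal: "is_crystal m \<B>"
  unfolding is_crystal_def
proof (intro conjI ballI)
  fix T assume "T \<in> elems \<B>"
  then have T: "T \<in> tableaux m lam \<alpha>" by simp
  have "set (reading_word lam \<alpha> T) \<subseteq> letters m"
    using entry_mem[OF T] by (auto simp: reading_word_def set_reading_order)
  then show "cwt \<B> T \<in> weights m" by (simp add: weights_def keys_cwt)
next
  fix i T assume i: "i \<in> indices m" and "T \<in> elems \<B>"
  then have T: "T \<in> tableaux m lam \<alpha>" by simp
  note f = tableau_f_iff[OF T i] and e = tableau_e_iff[OF T i]
  have fT: "T' \<in> tableaux m lam \<alpha>" if "cf \<B> i T = Some T'" for T'
    using that tableaux_f[OF T i] unfolding f by blast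
  then show "cf \<B> i T \<in> insert None (Some ` elems \<B>)" by (cases "cf \<B> i T") auto
  have eT: "T' \<in> tableaux m lam \<alpha>" if "ce \<B> i T = Some T'" for T'
    using that tableaux_e[OF T i] unfolding e by blast
  then show "ce \<B> i T \<in> insert None (Some ` elems \<B>)" by (cases "ce \<B> i T") auto
  show "isotropic i \<longrightarrow> cphi \<B> i T + ceps \<B> i T = (if pairing (cwt \<B> T) (simple_root i) \<noteq> 0 then 1 else 0)"
  proof
    assume "isotropic i"
    then have "0 \<le> i" using isotropic_iff[OF i] by simp
    then show "cphi \<B> i T + ceps \<B> i T = (if pairing (cwt \<B> T) (simple_root i) \<noteq> 0 then 1 else 0)"
      using isotropic_phi_plus_eps[OF i] pairing_cwt_eq_0_iff[OF i]
      by (auto simp: pairing_commute[of _ "simple_root i"])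
  qed
  show "\<not> isotropic i \<longrightarrow> int (cphi \<B> i T) - int (ceps \<B> i T) = pairing (cwt \<B> T) (simple_root i)"
    using isotropic_iff[OF i] phi_minus_eps_neg[OF i] by (simp add: pairing_commute[of _ "simple_root i"])
  show "\<forall>T'. cf \<B> i T = Some T' \<longrightarrow> int (ceps \<B> i T') = int (ceps \<B> i T) + 1 \<and>
    int (cphi \<B> i T') = int (cphi \<B> i T) - 1 \<and> cwt \<B> T' = cwt \<B> T - simple_root i"
    unfolding f using acts_on_crystal_data[OF i] by fastforce
  show "\<forall>T'. ce \<B> i T = Some T' \<longrightarrow> int (ceps \<B> i T') = int (ceps \<B> i T) - 1 \<and>
    int (cphi \<B> i T') = int (cphi \<B> i T) + 1 \<and> cwt \<B> T' = cwt \<B> T + simple_root i"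
  proof (intro allI impI)
    fix T' assume "ce \<B> i T = Some T'"
    then obtain x where x: "acts_on lam \<alpha> i T x" "T x = root_target i" "T' = T(x := root_source i)"
      unfolding e by blast
    then have "acts_on lam \<alpha> i T' x" "T' x = root_source i" "T = T'(x := root_target i)" by auto
    from acts_on_crystal_data[OF i this]
    show "int (ceps \<B> i T') = int (ceps \<B> i T) - 1 \<and>
      int (cphi \<B> i T') = int (cphi \<B> i T) + 1 \<and> cwt \<B> T' = cwt \<B> T + simple_root i" by simp
  qed
  fix T' assume "T' \<in> elems \<B>"
  then have T': "T' \<in> tableaux m lam \<alpha>" by simp
  \<comment> \<open>Both sides name the same node: \<open>acts_on\<close> survives the update at
    \<open>x\<close>, and the second update undoes the first.\<close>
  show "cf \<B> i T = Some T' \<longleftrightarrow> ce \<B> i T' = Some T"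
    unfolding f tableau_e_iff[OF T' i]
    by (metis acts_on_upd fun_upd_same fun_upd_triv fun_upd_upd)
qed

lemma highest_tableau_generates:
  "T \<in> tableaux m lam \<alpha> \<Longrightarrow>
    \<exists>ks. set ks \<subseteq> indices m \<and> f_string \<B> ks (highest_tableau lam \<alpha>) = Some T"
\<comment> \<open>Adding \<open>m\<close> makes every summand non-negative, and the factor 2 turns a
  drop of at least 1/2 in one entry into a drop of at least 1, which survives the floor.\<close>
proof (induction "nat \<lfloor>2 * (\<Sum>x\<in>\<D>. T x + of_nat m)\<rfloor>" arbitrary: T rule: less_induct)
  case less
  note T = less.prems
  show ?case
  proof (cases "\<forall>i\<in>indices m. ce (word_crystal m) i (reading_word lam \<alpha> T) = None")
    case True
    then have "T = highest_tableau lam \<alpha>" using source_eq_highest[OF T] by blast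
    then show ?thesis by (intro exI[of _ "[]"]) simp
  next
    case False
    then obtain i T' where i: "i \<in> indices m" and e: "ce \<B> i T = Some T'" by auto
    then obtain x where x: "acts_on lam \<alpha> i T x" "T x = root_target i" "T' = T(x := root_source i)"
      unfolding tableau_e_iff[OF T i] by blast
    have T': "T' \<in> tableaux m lam \<alpha>" and f: "cf \<B> i T' = Some T"
      using is_crystal_e[OF tableau_is_crystal i _ e] T by (auto simp del: tableau_crystal_simps(6))
    have xD: "x \<in> \<D>" using x(1) by (rule acts_on_in_diagram)
    have nonneg: "0 \<le> S y + of_nat m" if "S \<in> tableaux m lam \<alpha>" "y \<in> \<D>" for S y
      using entry_mem[OF that] by (auto simp: letters_def)
    have "(\<Sum>y\<in>\<D>. T y + of_nat m) = T x + of_nat m + (\<Sum>y\<in>\<D> - {x}. T y + of_nat m)"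
      "(\<Sum>y\<in>\<D>. T' y + of_nat m) = T' x + of_nat m + (\<Sum>y\<in>\<D> - {x}. T' y + of_nat m)"
      by (rule sum.remove[OF finite_diagram xD])+
    moreover have "(\<Sum>y\<in>\<D> - {x}. T' y + of_nat m) = (\<Sum>y\<in>\<D> - {x}. T y + of_nat m)"
      using x(3) by (intro sum.cong) auto
    moreover have "T' x + 1/2 \<le> T x" using x root_source_less_half[of i] by simp
    ultimately have "2 * (\<Sum>y\<in>\<D>. T' y + of_nat m) + 1 \<le> 2 * (\<Sum>y\<in>\<D>. T y + of_nat m)" by simp
    then have "\<lfloor>2 * (\<Sum>y\<in>\<D>. T' y + of_nat m)\<rfloor> < \<lfloor>2 * (\<Sum>y\<in>\<D>. T y + of_nat m)\<rfloor>"
      by (simp add: floor_less_iff less_floor_iff) linarith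
    moreover have "0 \<le> \<lfloor>2 * (\<Sum>y\<in>\<D>. T' y + of_nat m)\<rfloor>"
      using nonneg[OF T'] by (simp add: sum_nonneg)
    ultimately have "nat \<lfloor>2 * (\<Sum>y\<in>\<D>. T' y + of_nat m)\<rfloor> < nat \<lfloor>2 * (\<Sum>y\<in>\<D>. T y + of_nat m)\<rfloor>"
      by (simp only: nat_less_eq_zless)
    then obtain ks where "set ks \<subseteq> indices m" "f_string \<B> ks (highest_tableau lam \<alpha>) = Some T'"
      using less.hyps[OF _ T'] by blast
    \<comment> \<open>\<open>f_string\<close> applies the head of the list last, so the operator
      leading from \<open>T'\<close> back to \<open>T\<close> goes in front.\<close>
    then show ?thesis using f i by (intro exI[of _ "i # ks"]) (simp del: tableau_crystal_simps(6))
  qed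
qed

end

theorem proposition5p1:
  fixes m :: nat and lam \<alpha> :: "nat list"
  assumes "(lam, \<alpha>) \<in> shapes m"
  shows "is_crystal m (tableau_crystal m lam \<alpha>) \<and>
    Some ` tableaux m lam \<alpha> =
      {f_string (tableau_crystal m lam \<alpha>) ks (highest_tableau lam \<alpha>) | ks. set ks \<subseteq> indices m} - {None} \<and>
    crystal_connected m (tableau_crystal m lam \<alpha>) \<and>
    highest_weight_elems m (tableau_crystal m lam \<alpha>) = {highest_tableau lam \<alpha>}"
proof -
  interpret tail_shape m lam \<alpha> by unfold_locales (rule assms)
  show ?thesis
    using generated_crystal[OF tableau_is_crystal, of "highest_tableau lam \<alpha>"]
      tableau_is_crystal highest_tableau_mem highest_tableau_generates
    by simp
qed

end
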